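(* Let $\Omega\subseteq\mathbb{C}$ be a connected open set, let $n$ be a positive integer, and let $T$ and $\tilde T$ be two operators in $\mathcal{F}B_n(\Omega)$, acting on $\mathcal{H}=\mathcal{H}_0\oplus\cdots\oplus\mathcal{H}_{n-1}$ and $\tilde{\mathcal{H}}=\tilde{\mathcal{H}}_0\oplus\cdots\oplus\tilde{\mathcal{H}}_{n-1}$ respectively, with diagonal entries $T_i$, $\tilde T_i$ ($0\le i\le n-1$) and entries above the diagonal $S_{i,j}$, $\tilde S_{i,j}$ ($0\le i<j\le n-1$). Then $T$ and $\tilde T$ are unitarily equivalent if and only if there exist unitary operators $U_i:\mathcal{H}_i\to\tilde{\mathcal{H}}_i$, $0\le i\le n-1$, such that $U_iT_i=\tilde T_iU_i$ for all $0\le i\le n-1$ and $U_iS_{i,j}=\tilde S_{i,j}U_j$ for all $0\le i<j\le n-1$.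
   Context: All Hilbert spaces are complex and separable and all operators are bounded and linear. For a connected open set $\Omega\subseteq\mathbb{C}$ and a positive integer $n$, $B_n(\Omega)$ (the Cowen-Douglas class) is the set of bounded operators $T$ on a Hilbert space $\mathcal{H}$ such that $\Omega\subset\sigma(T)$; $\mathrm{ran}(T-w)=\mathcal{H}$ for all $w\in\Omega$; the closed linear span of $\bigcup_{w\in\Omega}\ker(T-w)$ is $\mathcal{H}$; and $\dim\ker(T-w)=n$ for all $w\in\Omega$. $\mathcal{F}B_n(\Omega)$ is the set of bounded operators $T$ on a Hilbert space given as an orthogonal direct sum $\mathcal{H}=\mathcal{H}_0\oplus\cdots\oplus\mathcal{H}_{n-1}$ whose block matrix is upper triangular, with diagonal entries $T_i:\mathcal{H}_i\to\mathcal{H}_i$ in $B_1(\Omega)$ ($0\le i\le n-1$), entries $S_{i,j}:\mathcal{H}_j\to\mathcal{H}_i$ in position $(i,j)$ for $i<j$, and zero entries below the diagonal, where each $S_{i,i+1}$ is non-zero and $T_iS_{i,i+1}=S_{i,i+1}T_{i+1}$ for $0\le i\le n-2$. *)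

theory Defs
  imports "HOL-Analysis.Analysis"
begin

class complex_vector = real_vector +
  fixes scaleC :: "complex \<Rightarrow> 'a \<Rightarrow> 'a" (infixr \<open>*\<^sub>C\<close> 75)
  assumes scaleC_add_right: "a *\<^sub>C (x + y) = a *\<^sub>C x + a *\<^sub>C y"
    and scaleC_add_left: "(a + b) *\<^sub>C x = a *\<^sub>C x + b *\<^sub>C x"
    and scaleC_scaleC: "a *\<^sub>C b *\<^sub>C x = (a * b) *\<^sub>C x"
    and scaleC_one: "1 *\<^sub>C x = x"
    and scaleR_scaleC: "r *\<^sub>R x = complex_of_real r *\<^sub>C x"

global_interpretation complex_vector: vector_space "scaleC :: complex \<Rightarrow> 'a \<Rightarrow> 'a :: complex_vector"
  defines csubspace = complex_vector.subspace
    and cspan = complex_vector.span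
    and cdim = complex_vector.dim
  by unfold_locales (simp_all add: scaleC_add_right scaleC_add_left scaleC_scaleC scaleC_one)

text \<open>The underlying real inner product is the real part of the complex one, so that norm and
  topology are the ones of \<^class>\<open>real_inner\<close> and the norm of \<open>x\<close> is the square root of
  \<open>cinner x x\<close>. The complex inner product is linear in the first argument.\<close>

class complex_inner = complex_vector + real_inner +
  fixes cinner :: "'a \<Rightarrow> 'a \<Rightarrow> complex"
  assumes cinner_commute: "cinner x y = cnj (cinner y x)"
    and cinner_add_left: "cinner (x + y) z = cinner x z + cinner y z"
    and cinner_scaleC_left: "cinner (a *\<^sub>C x) y = a * cinner x y"
    and Re_cinner: "Re (cinner x y) = inner x y"

class complex_hilbert = complex_inner + complete_space +
  assumes ex_countable_dense: "\<exists>D. countable D \<and> (\<forall>x. \<forall>e>0. \<exists>d\<in>D. dist x d < e)"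

instantiation complex :: complex_hilbert
begin

definition scaleC_complex :: "complex \<Rightarrow> complex \<Rightarrow> complex"
  where "scaleC_complex a x = a * x"

definition cinner_complex :: "complex \<Rightarrow> complex \<Rightarrow> complex"
  where "cinner_complex x y = x * cnj y"

instance
proof
  obtain D :: "complex set" where "countable D" "closure D = UNIV"
    using separable[of "UNIV :: complex set"] by (metis top.extremum_uniqueI)
  then show "\<exists>D :: complex set. countable D \<and> (\<forall>x. \<forall>e>0. \<exists>d\<in>D. dist x d < e)"
    using closure_approachable[of _ D] by (metis UNIV_I dist_commute)
qed (auto simp: scaleC_complex_def cinner_complex_def inner_complex_def algebra_simps
      scaleR_conv_of_real)

end

text \<open>The summands of an orthogonal direct sum are closed subspaces of the ambient space, hence
  Hilbert spaces in their own right. An operator between closed subspaces \<open>K\<close> and \<open>L\<close> is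
  represented by a total function of which only the values on \<open>K\<close> matter; operators on the whole
  space are the case \<open>K = L = UNIV\<close>.\<close>

definition closed_csubspace :: "'a::complex_hilbert set \<Rightarrow> bool"
  where "closed_csubspace K \<longleftrightarrow> csubspace K \<and> closed K"

definition clinear_on :: "'a::complex_hilbert set \<Rightarrow> 'b::complex_hilbert set \<Rightarrow> ('a \<Rightarrow> 'b) \<Rightarrow> bool"
  where "clinear_on K L f \<longleftrightarrow> f ` K \<subseteq> L
    \<and> (\<forall>x\<in>K. \<forall>y\<in>K. f (x + y) = f x + f y) \<and> (\<forall>c. \<forall>x\<in>K. f (c *\<^sub>C x) = c *\<^sub>C f x)"

definition bounded_op :: "'a::complex_hilbert set \<Rightarrow> 'b::complex_hilbert set \<Rightarrow> ('a \<Rightarrow> 'b) \<Rightarrow> bool"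
  where "bounded_op K L f \<longleftrightarrow> clinear_on K L f \<and> (\<exists>C. \<forall>x\<in>K. norm (f x) \<le> C * norm x)"

definition unitary_op :: "'a::complex_hilbert set \<Rightarrow> 'b::complex_hilbert set \<Rightarrow> ('a \<Rightarrow> 'b) \<Rightarrow> bool"
  where "unitary_op K L U \<longleftrightarrow> clinear_on K L U \<and> U ` K = L
    \<and> (\<forall>x\<in>K. \<forall>y\<in>K. cinner (U x) (U y) = cinner x y)"

definition unitarily_equivalent ::
    "('a::complex_hilbert \<Rightarrow> 'a) \<Rightarrow> ('b::complex_hilbert \<Rightarrow> 'b) \<Rightarrow> bool"
  where "unitarily_equivalent T T' \<longleftrightarrow>
    (\<exists>U. unitary_op UNIV UNIV U \<and> (\<forall>x. U (T x) = T' (U x)))"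

definition op_spectrum :: "'a::complex_hilbert set \<Rightarrow> ('a \<Rightarrow> 'a) \<Rightarrow> complex set"
  where "op_spectrum K T = {w. \<not> (\<exists>R. bounded_op K K R
    \<and> (\<forall>x\<in>K. R (T x - w *\<^sub>C x) = x \<and> T (R x) - w *\<^sub>C R x = x))}"

definition eigenspace :: "'a::complex_hilbert set \<Rightarrow> ('a \<Rightarrow> 'a) \<Rightarrow> complex \<Rightarrow> 'a set"
  where "eigenspace K T w = {x \<in> K. T x - w *\<^sub>C x = 0}"

text \<open>The dimension \<^const>\<open>cdim\<close> of an infinite-dimensional space is \<open>0\<close>; because of the conjunct
  \<open>0 < n\<close> the condition on it does force the eigenspaces to have dimension exactly \<open>n\<close>.\<close>

definition cowen_douglas ::
    "nat \<Rightarrow> complex set \<Rightarrow> 'a::complex_hilbert set \<Rightarrow> ('a \<Rightarrow> 'a) \<Rightarrow> bool"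
  where "cowen_douglas n \<Omega> K T \<longleftrightarrow> 0 < n \<and> closed_csubspace K \<and> bounded_op K K T
    \<and> \<Omega> \<subseteq> op_spectrum K T
    \<and> (\<forall>w\<in>\<Omega>. (\<lambda>x. T x - w *\<^sub>C x) ` K = K)
    \<and> closure (cspan (\<Union>w\<in>\<Omega>. eigenspace K T w)) = K
    \<and> (\<forall>w\<in>\<Omega>. cdim (eigenspace K T w) = n)"

definition orthogonal_direct_sum :: "nat \<Rightarrow> (nat \<Rightarrow> 'a::complex_hilbert set) \<Rightarrow> bool"
  where "orthogonal_direct_sum n H \<longleftrightarrow> (\<forall>i<n. closed_csubspace (H i))
    \<and> (\<forall>i<n. \<forall>j<n. i \<noteq> j \<longrightarrow> (\<forall>x\<in>H i. \<forall>y\<in>H j. cinner x y = 0))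
    \<and> (\<forall>x. \<exists>h. (\<forall>i<n. h i \<in> H i) \<and> x = (\<Sum>i<n. h i))"

text \<open>\<open>A i j\<close> is the entry in row \<open>i\<close> and column \<open>j\<close>, an operator from \<open>H j\<close> to \<open>H i\<close>.\<close>

definition has_block_matrix ::
    "nat \<Rightarrow> (nat \<Rightarrow> 'a::complex_hilbert set) \<Rightarrow> ('a \<Rightarrow> 'a) \<Rightarrow> (nat \<Rightarrow> nat \<Rightarrow> 'a \<Rightarrow> 'a) \<Rightarrow> bool"
  where "has_block_matrix n H T A \<longleftrightarrow>
    (\<forall>i<n. \<forall>j<n. bounded_op (H j) (H i) (A i j))
    \<and> (\<forall>j<n. \<forall>x\<in>H j. T x = (\<Sum>i<n. A i j x))"

text \<open>\<open>FB_class n \<Omega> H T D S\<close>: the operator \<open>T\<close> on the orthogonal direct sum of the spaces \<open>H i\<close>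
  belongs to \<open>FB\<^sub>n(\<Omega>)\<close>, with diagonal entries \<open>D i\<close> and entries \<open>S i j\<close>, \<open>i < j\<close>, above the diagonal.\<close>

definition FB_class ::
    "nat \<Rightarrow> complex set \<Rightarrow> (nat \<Rightarrow> 'a::complex_hilbert set) \<Rightarrow> ('a \<Rightarrow> 'a)
      \<Rightarrow> (nat \<Rightarrow> 'a \<Rightarrow> 'a) \<Rightarrow> (nat \<Rightarrow> nat \<Rightarrow> 'a \<Rightarrow> 'a) \<Rightarrow> bool"
  where "FB_class n \<Omega> H T D S \<longleftrightarrow> bounded_op UNIV UNIV T \<and> orthogonal_direct_sum n H
    \<and> has_block_matrix n H T
        (\<lambda>i j. if i = j then D i else if i < j then S i j else (\<lambda>x. 0))
    \<and> (\<forall>i<n. cowen_douglas 1 \<Omega> (H i) (D i))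
    \<and> (\<forall>i. Suc i < n \<longrightarrow> (\<exists>x\<in>H (Suc i). S i (Suc i) x \<noteq> 0)
        \<and> (\<forall>x\<in>H (Suc i). D i (S i (Suc i) x) = S i (Suc i) (D (Suc i) x)))"

end

theory Submission
  imports Defs "HOL-Complex_Analysis.Complex_Analysis"
begin

text \<open>A unitary \<open>X\<close> with \<open>X T = T' X\<close> turns out to be block diagonal, and its diagonal blocks are the
  required unitaries. This rests on two facts about operators in \<open>B\<^sub>1(\<Omega>)\<close>. Their eigenvectors
  depend locally holomorphically on the eigenvalue, so by the identity theorem a composition of
  nonzero intertwiners is nonzero. And a nonzero operator commuting with \<open>T\<close> is never a commutator
  \<open>T B - B T\<close>, by the argument of Kleinecke and Shirokov.

  Let \<open>Y\<close> be the inverse of \<open>X\<close>. If the first column of \<open>X\<close> has a nonzero entry below the diagonal,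
  the lowest one is an intertwiner; going to the next columns, the lowest nonzero entries are
  intertwiners in strictly lower rows, until at some column \<open>j\<close> with lowest row \<open>i\<close> the entry
  \<open>B = X\<^sub>i\<^sub>,\<^sub>j\<^sub>+\<^sub>1\<close> satisfies \<open>T'\<^sub>i B - B T\<^sub>j\<^sub>+\<^sub>1 = X\<^sub>i\<^sub>j S\<^sub>j\<^sub>,\<^sub>j\<^sub>+\<^sub>1 \<noteq> 0\<close>. If the same happens for \<open>Y\<close>, then the
  intertwiners in \<open>X\<close>, \<open>Y\<close> and the entries next to the diagonal of \<open>T\<close> and \<open>T'\<close> form a cycle
  through \<open>B\<close>, which contradicts the second fact. So the first column of \<open>X\<close> or of \<open>Y\<close> vanishes below
  the diagonal, hence both do, because \<open>Y X = 1\<close> and nonzero intertwiners have nonzero product. As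
  \<open>X\<close> is unitary, its first row is diagonal too, and one continues with the next column.\<close>



section \<open>Operators between closed subspaces\<close>

instance complex_hilbert \<subseteq> banach ..

lemma cinner_add_right: "cinner x (y + z) = cinner x y + cinner x z"
  for x :: "'a::complex_inner"
  by (metis cinner_add_left cinner_commute complex_cnj_add)

lemma cinner_scaleC_right: "cinner x (a *\<^sub>C y) = cnj a * cinner x y"
  for x :: "'a::complex_inner"
  by (metis cinner_commute cinner_scaleC_left complex_cnj_mult)

lemma cinner_zero_left [simp]: "cinner 0 y = 0" for y :: "'a::complex_inner"
  using cinner_add_left[of 0 0 y] by simp

lemma cinner_zero_right [simp]: "cinner y 0 = 0" for y :: "'a::complex_inner"
  using cinner_add_right[of y 0 0] by simp

lemma cinner_sum_left: "cinner (sum f A) y = (\<Sum>i\<in>A. cinner (f i) y)"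
  for y :: "'a::complex_inner"
  by (induction A rule: infinite_finite_induct) (auto simp: cinner_add_left)

lemma cinner_sum_right: "cinner y (sum f A) = (\<Sum>i\<in>A. cinner y (f i))"
  for y :: "'a::complex_inner"
  by (induction A rule: infinite_finite_induct) (auto simp: cinner_add_right)

lemma cinner_self: "cinner x x = complex_of_real ((norm x)\<^sup>2)" for x :: "'a::complex_inner"
proof -
  have "Im (cinner x x) = 0"
    using arg_cong[OF cinner_commute[of x x], of Im] by simp
  moreover have "Re (cinner x x) = (norm x)\<^sup>2"
    by (simp add: Re_cinner power2_norm_eq_inner)
  ultimately show ?thesis by (simp add: complex_eq_iff)
qed

lemma cinner_self_eq_0 [simp]: "cinner x x = 0 \<longleftrightarrow> x = 0" for x :: "'a::complex_inner"
  by (simp add: cinner_self)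

lemma norm_scaleC: "norm (c *\<^sub>C x) = cmod c * norm x" for x :: "'a::complex_inner"
proof -
  have "cinner (c *\<^sub>C x) (c *\<^sub>C x) = (c * cnj c) * cinner x x"
    by (simp add: cinner_scaleC_left cinner_scaleC_right)
  then have "complex_of_real ((norm (c *\<^sub>C x))\<^sup>2) = complex_of_real ((cmod c * norm x)\<^sup>2)"
    by (simp only: cinner_self complex_norm_square[symmetric]) (simp add: power_mult_distrib)
  then have "(norm (c *\<^sub>C x))\<^sup>2 = (cmod c * norm x)\<^sup>2"
    using of_real_eq_iff by blast
  then show ?thesis by (simp add: power2_eq_iff_nonneg)
qed

text \<open>Multiplying \<open>x\<close> by a unimodular scalar makes the complex inner product
  equal to its modulus, and the real Cauchy-Schwarz inequality applies.\<close>

lemma norm_cinner_le: "cmod (cinner x y) \<le> norm x * norm y" for x :: "'a::complex_inner"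
proof (cases "cinner x y = 0")
  case False
  define u where "u = cnj (sgn (cinner x y))"
  have u: "cmod u = 1" using False by (simp add: u_def norm_sgn)
  have "cinner (u *\<^sub>C x) y = complex_of_real (cmod (cinner x y))"
    using False complex_norm_square[of "cinner x y"]
    by (simp add: cinner_scaleC_left u_def sgn_eq power2_eq_square mult.commute field_simps)
  then have "cmod (cinner x y) = inner (u *\<^sub>C x) y"
    by (metis Re_cinner Re_complex_of_real)
  also have "\<dots> \<le> norm (u *\<^sub>C x) * norm y" by (rule norm_cauchy_schwarz)
  finally show ?thesis by (simp add: norm_scaleC u)
qed simp

lemma closed_csubspaceD:
  assumes "closed_csubspace K"
  shows "0 \<in> K" "x \<in> K \<Longrightarrow> y \<in> K \<Longrightarrow> x + y \<in> K" "x \<in> K \<Longrightarrow> y \<in> K \<Longrightarrow> x - y \<in> K"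
    "x \<in> K \<Longrightarrow> c *\<^sub>C x \<in> K" "x \<in> K \<Longrightarrow> r *\<^sub>R x \<in> K"
    "(\<And>i. i \<in> I \<Longrightarrow> f i \<in> K) \<Longrightarrow> sum f I \<in> K" "closed K"
  using assms unfolding closed_csubspace_def
  by (auto simp: complex_vector.subspace_0 complex_vector.subspace_add complex_vector.subspace_diff
      complex_vector.subspace_scale complex_vector.subspace_sum scaleR_scaleC)

lemma closed_csubspace_UNIV [simp]: "closed_csubspace UNIV"
  by (simp add: closed_csubspace_def)

lemma bounded_opD:
  assumes "bounded_op K L A"
  shows "x \<in> K \<Longrightarrow> A x \<in> L" "x \<in> K \<Longrightarrow> y \<in> K \<Longrightarrow> A (x + y) = A x + A y"
    "x \<in> K \<Longrightarrow> A (c *\<^sub>C x) = c *\<^sub>C A x" "x \<in> K \<Longrightarrow> A (r *\<^sub>R x) = r *\<^sub>R A x"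
  using assms unfolding bounded_op_def clinear_on_def by (auto simp: scaleR_scaleC)

lemma bounded_op_0: "closed_csubspace K \<Longrightarrow> bounded_op K L A \<Longrightarrow> A 0 = 0"
  using bounded_opD(4)[of K L A 0 0] closed_csubspaceD(1)[of K] by simp

lemma bounded_op_diff:
  assumes "closed_csubspace K" "bounded_op K L A" "x \<in> K" "y \<in> K"
  shows "A (x - y) = A x - A y"
  using bounded_opD(2)[OF assms(2), of "x - y" y] closed_csubspaceD(3)[OF assms(1)] assms by simp

lemma bounded_op_sum:
  assumes "closed_csubspace K" "bounded_op K L A" "\<And>i. i \<in> I \<Longrightarrow> f i \<in> K"
  shows "A (sum f I) = (\<Sum>i\<in>I. A (f i))"
  using assms(3)
proof (induction I rule: infinite_finite_induct)
  case (insert i I)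
  then show ?case
    using bounded_opD(2)[OF assms(2), of "f i" "sum f I"] closed_csubspaceD(6)[OF assms(1), of I f]
    by auto
qed (auto simp: bounded_op_0[OF assms(1,2)])

lemma bounded_op_bound:
  assumes "bounded_op K L A"
  obtains C where "C > 0" "\<And>x. x \<in> K \<Longrightarrow> norm (A x) \<le> C * norm x"
proof -
  obtain C where C: "\<forall>x\<in>K. norm (A x) \<le> C * norm x"
    using assms by (auto simp: bounded_op_def)
  have "norm (A x) \<le> max C 1 * norm x" if "x \<in> K" for x
    using C that by (meson max.cobounded1 mult_right_mono norm_ge_zero order_trans)
  then show ?thesis using that[of "max C 1"] by simp
qed

lemma bounded_opI:
  assumes "\<And>x. x \<in> K \<Longrightarrow> A x \<in> L" "\<And>x y. x \<in> K \<Longrightarrow> y \<in> K \<Longrightarrow> A (x + y) = A x + A y"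
    "\<And>c x. x \<in> K \<Longrightarrow> A (c *\<^sub>C x) = c *\<^sub>C A x" "\<And>x. x \<in> K \<Longrightarrow> norm (A x) \<le> C * norm x"
  shows "bounded_op K L A"
  using assms unfolding bounded_op_def clinear_on_def by blast

lemma bounded_op_compose:
  assumes "bounded_op K L A" "bounded_op L M B"
  shows "bounded_op K M (\<lambda>x. B (A x))"
proof -
  obtain C where C: "C > 0" "\<And>x. x \<in> K \<Longrightarrow> norm (A x) \<le> C * norm x"
    using bounded_op_bound[OF assms(1)] by metis
  obtain E where E: "E > 0" "\<And>x. x \<in> L \<Longrightarrow> norm (B x) \<le> E * norm x"
    using bounded_op_bound[OF assms(2)] by metis
  have "norm (B (A x)) \<le> (E * C) * norm x" if "x \<in> K" for x
    using E(2)[of "A x"] C(2)[OF that] E(1) bounded_opD(1)[OF assms(1) that]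
    by (smt (verit) mult.assoc mult_left_mono)
  then show ?thesis
    using bounded_opD[OF assms(1)] bounded_opD[OF assms(2)] by (intro bounded_opI) auto
qed

lemma bounded_op_diff_scaleC:
  assumes "closed_csubspace K" "bounded_op K K T"
  shows "bounded_op K K (\<lambda>x. T x - w *\<^sub>C x)"
proof -
  obtain C where C: "C > 0" "\<And>x. x \<in> K \<Longrightarrow> norm (T x) \<le> C * norm x"
    using bounded_op_bound[OF assms(2)] by metis
  have "norm (T x - w *\<^sub>C x) \<le> (C + cmod w) * norm x" if "x \<in> K" for x
    using C(2)[OF that] norm_triangle_ineq4[of "T x" "w *\<^sub>C x"]
    by (simp add: norm_scaleC distrib_right)
  then show ?thesis
    using bounded_opD[OF assms(2)] closed_csubspaceD[OF assms(1)]
    by (intro bounded_opI) (auto simp: complex_vector.scale_right_distrib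
        complex_vector.scale_right_diff_distrib complex_vector.scale_left_commute)
qed

text \<open>\<open>A\<close> is controlled only on \<open>K\<close>, so continuity comes from the
  bound on differences of partial sums; closedness of \<open>K\<close> keeps the limit
  inside.\<close>

lemma bounded_op_sums:
  assumes "closed_csubspace K" "bounded_op K L A" "\<And>i. f i \<in> K" "f sums s"
  shows "s \<in> K" "(\<lambda>i. A (f i)) sums A s"
proof -
  have part: "sum f {..<n} \<in> K" for n
    by (rule closed_csubspaceD(6)[OF assms(1)]) (rule assms(3))
  show s: "s \<in> K"
    using closed_sequentially[OF closed_csubspaceD(7)[OF assms(1)], of "\<lambda>n. sum f {..<n}" s]
      part assms(4) by (simp add: sums_def)
  obtain C where C: "C > 0" "\<And>x. x \<in> K \<Longrightarrow> norm (A x) \<le> C * norm x"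
    using bounded_op_bound[OF assms(2)] by metis
  have "(\<lambda>n. C * norm (sum f {..<n} - s)) \<longlonglongrightarrow> C * norm (s - s)"
    using assms(4) unfolding sums_def by (intro tendsto_intros)
  then have "(\<lambda>n. C * norm (sum f {..<n} - s)) \<longlonglongrightarrow> 0" by simp
  moreover have "norm (A (sum f {..<n}) - A s) \<le> C * norm (sum f {..<n} - s)" for n
    using C(2)[of "sum f {..<n} - s"] part s bounded_op_diff[OF assms(1,2) part s]
      closed_csubspaceD(3)[OF assms(1)] by simp
  ultimately have "(\<lambda>n. A (sum f {..<n}) - A s) \<longlonglongrightarrow> 0"
    by (rule Lim_null_comparison[OF always_eventually[OF allI], rotated])
  then have "(\<lambda>n. A (sum f {..<n})) \<longlonglongrightarrow> A s" by (simp add: LIM_zero_iff)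
  then show "(\<lambda>i. A (f i)) sums A s"
    unfolding sums_def using bounded_op_sum[OF assms(1,2), of "{..<n}" f for n] assms(3) by simp
qed

text \<open>Pairing with a fixed vector turns vector-valued questions into scalar ones, where
  holomorphy and the identity theorem apply.\<close>

lemma cinner_bounded_op:
  assumes "bounded_op K L A"
  shows "bounded_op K UNIV (\<lambda>x. cinner (A x) y)"
proof -
  obtain C where C: "C > 0" "\<And>x. x \<in> K \<Longrightarrow> norm (A x) \<le> C * norm x"
    using bounded_op_bound[OF assms] by metis
  have "cmod (cinner (A x) y) \<le> (C * norm y) * norm x" if "x \<in> K" for x
    using norm_cinner_le[of "A x" y] mult_right_mono[OF C(2)[OF that] norm_ge_zero[of y]]
    by (simp add: mult.commute mult.left_commute)
  then show ?thesis
    using bounded_opD[OF assms]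
    by (intro bounded_opI) (auto simp: cinner_add_left cinner_scaleC_left scaleC_complex_def)
qed

section \<open>The open mapping theorem\<close>

text \<open>By Baire, the closure of the image of some ball has interior in \<open>L\<close>.
  Differences move this to the origin, and scaling gives preimages with relative error one
  half.\<close>

lemma surj_bounded_op_approximate_preimage:
  assumes K: "closed_csubspace K" and L: "closed_csubspace L"
    and A: "bounded_op K L A" and surj: "A ` K = L"
  obtains c where "c > 0"
    "\<And>y. y \<in> L \<Longrightarrow> \<exists>x\<in>K. norm x \<le> c * norm y \<and> norm (y - A x) \<le> norm y / 2"
proof -
  define G where "G n = L \<inter> closure (A ` (K \<inter> cball 0 (real n)))" for n :: nat
  let ?X = "top_of_set L"
  have cover: "\<Union>(range G) = L"
  proof -
    have "y \<in> \<Union>(range G)" if "y \<in> L" for y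
    proof -
      obtain x where x: "x \<in> K" "A x = y" using surj \<open>y \<in> L\<close> by blast
      obtain n :: nat where "norm x \<le> real n" using real_arch_simple by blast
      then have "y \<in> G n" using x that unfolding G_def
        using closure_subset[of "A ` (K \<inter> cball 0 (real n))"] by auto
      then show ?thesis by blast
    qed
    then show ?thesis by (auto simp: G_def)
  qed
  have "\<exists>n. ?X interior_of G n \<noteq> {}"
  proof (rule ccontr)
    assume "\<not> ?thesis"
    then have "?X interior_of \<Union>(range G) = {}"
      by (intro Baire_category_alt)
        (use closed_csubspaceD(7)[OF L] in \<open>auto simp: G_def closedin_closed_Int
          completely_metrizable_space_closedin completely_metrizable_space_euclidean\<close>)
    moreover have "?X interior_of L = L"
      by (metis interior_of_topspace topspace_euclidean_subtopology)
    ultimately show False using cover closed_csubspaceD(1)[OF L] by auto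
  qed
  then obtain n y0 where "y0 \<in> ?X interior_of G n" by blast
  then obtain W where W: "openin ?X W" "y0 \<in> W" "W \<subseteq> G n" by (auto simp: interior_of_def)
  then obtain e where e: "e > 0" "ball y0 e \<inter> L \<subseteq> W" and y0: "y0 \<in> L"
    by (metis openin_contains_ball openin_imp_subset subsetD)
  \<comment> \<open>One factor 2 comes from subtracting two preimages, the other from scaling
    \<open>y\<close> to norm \<open>e / 2\<close>; the \<open>+ 1\<close> keeps \<open>c\<close>
    positive when \<open>n = 0\<close>.\<close>
  define c where "c = 4 * (real n + 1) / e"
  have small: "\<exists>x\<in>K. norm x \<le> 2 * real n \<and> norm (y - A x) \<le> d"
    if y: "y \<in> L" "norm y < e" and d: "d > 0" for y d
  proof -
    \<comment> \<open>\<open>G n\<close> surrounds \<open>y0\<close> instead of the origin, so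
      \<open>y\<close> is written as the difference of \<open>y0 + y\<close> and
      \<open>y0\<close>.\<close>
    have "y0 + y \<in> G n" "y0 \<in> G n"
      using W e y y0 closed_csubspaceD(2)[OF L y0 y(1)] by (auto simp: dist_norm subset_iff)
    then have "\<exists>x\<in>K. norm x \<le> n \<and> dist (A x) z < d / 2" if "z \<in> {y0 + y, y0}" for z
      using that closure_approachableD[of z "A ` (K \<inter> cball 0 (real n))" "d / 2"] d
      unfolding G_def by (fastforce simp: dist_commute Bex_def)
    then obtain x1 x2 where x1: "x1 \<in> K" "norm x1 \<le> n" "dist (A x1) (y0 + y) < d / 2"
      and x2: "x2 \<in> K" "norm x2 \<le> n" "dist (A x2) y0 < d / 2"
      by (metis insertI1 insertI2)
    have "norm (y - A (x1 - x2)) = norm ((A x2 - y0) - (A x1 - (y0 + y)))"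
      by (simp add: bounded_op_diff[OF K A x1(1) x2(1)] algebra_simps)
    also have "\<dots> \<le> d / 2 + d / 2"
      using x1 x2 by (smt (verit) dist_norm norm_triangle_ineq4)
    finally have "norm (y - A (x1 - x2)) \<le> d" by simp
    moreover have "norm (x1 - x2) \<le> 2 * real n"
      using x1 x2 norm_triangle_ineq4[of x1 x2] by simp
    ultimately show ?thesis using closed_csubspaceD(3)[OF K x1(1) x2(1)] by blast
  qed
  have "\<exists>x\<in>K. norm x \<le> c * norm y \<and> norm (y - A x) \<le> norm y / 2" if y: "y \<in> L" for y
  proof (cases "y = 0")
    case True
    then show ?thesis using closed_csubspaceD(1)[OF K] bounded_op_0[OF K A] by auto
  next
    case False
    define t where "t = e / (2 * norm y)"
    have t: "t > 0" using False e by (simp add: t_def)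
    have "norm (t *\<^sub>R y) < e" using False e by (simp add: t_def)
    then obtain x where x: "x \<in> K" "norm x \<le> 2 * real n" "norm (t *\<^sub>R y - A x) \<le> t * (norm y / 2)"
      using small[of "t *\<^sub>R y" "t * (norm y / 2)"] closed_csubspaceD(5)[OF L y] t False by auto
    let ?x = "inverse t *\<^sub>R x"
    have "norm ?x = inverse t * norm x" using t by simp
    also have "\<dots> \<le> inverse t * (2 * (real n + 1))"
      using x t by (intro mult_left_mono) auto
    also have "\<dots> = c * norm y" using False e by (simp add: t_def c_def field_simps)
    finally have 1: "norm ?x \<le> c * norm y" .
    have "y - A ?x = inverse t *\<^sub>R (t *\<^sub>R y - A x)"
      using bounded_opD(4)[OF A x(1)] t by (simp add: scaleR_diff_right)
    then have "norm (y - A ?x) = inverse t * norm (t *\<^sub>R y - A x)"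
      using t by simp
    also have "\<dots> \<le> inverse t * (t * (norm y / 2))"
      using x(3) t by (intro mult_left_mono) auto
    also have "\<dots> = norm y / 2" using t by simp
    finally have "norm (y - A ?x) \<le> norm y / 2" .
    with 1 show ?thesis using closed_csubspaceD(5)[OF K x(1)] by blast
  qed
  moreover have "c > 0" using e by (simp add: c_def add_pos_pos)
  ultimately show ?thesis using that by blast
qed

text \<open>Each correction halves the remaining error, so the corrections sum to an exact preimage,
  with norm bounded by a geometric series.\<close>

lemma surj_bounded_op_bounded_preimage:
  assumes K: "closed_csubspace K" and L: "closed_csubspace L"
    and A: "bounded_op K L A" and surj: "A ` K = L"
  obtains C where "C > 0" "\<And>y. y \<in> L \<Longrightarrow> \<exists>x\<in>K. A x = y \<and> norm x \<le> C * norm y"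
proof -
  obtain c where c: "c > 0"
    "\<And>y. y \<in> L \<Longrightarrow> \<exists>x\<in>K. norm x \<le> c * norm y \<and> norm (y - A x) \<le> norm y / 2"
    using surj_bounded_op_approximate_preimage[OF assms] by metis
  then obtain f where f: "\<And>y. y \<in> L \<Longrightarrow> f y \<in> K" "\<And>y. y \<in> L \<Longrightarrow> norm (f y) \<le> c * norm y"
    "\<And>y. y \<in> L \<Longrightarrow> norm (y - A (f y)) \<le> norm y / 2" by metis
  have "\<exists>x\<in>K. A x = y \<and> norm x \<le> (2 * c) * norm y" if y: "y \<in> L" for y
  proof -
    define r where "r k = ((\<lambda>z. z - A (f z)) ^^ k) y" for k
    have r0: "r 0 = y" and rS: "r (Suc k) = r k - A (f (r k))" for k by (simp_all add: r_def)
    have rL: "r k \<in> L" for k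
      by (induction k) (use y f bounded_opD(1)[OF A] closed_csubspaceD(3)[OF L] in
          \<open>auto simp: r0 rS\<close>)
    have rn: "norm (r k) \<le> norm y * (1/2) ^ k" for k
    proof (induction k)
      case (Suc k)
      then show ?case using f(3)[OF rL[of k]] by (simp add: rS)
    qed (simp add: r0)
    have fb: "norm (f (r k)) \<le> c * norm y * (1/2) ^ k" for k
      using f(2)[OF rL[of k]] mult_left_mono[OF rn[of k], of c] c(1) unfolding mult.assoc by linarith
    have geo: "(\<lambda>k. c * norm y * (1/2) ^ k) sums (c * norm y * (1 / (1 - 1/2)))"
      by (intro sums_mult geometric_sums) simp
    have sn: "summable (\<lambda>k. norm (f (r k)))"
      by (rule summable_comparison_test'[OF sums_summable[OF geo], of 0]) (simp add: fb)
    define x where "x = (\<Sum>k. f (r k))"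
    have xs: "(\<lambda>k. f (r k)) sums x"
      unfolding x_def using summable_norm_cancel[OF sn] summable_sums by blast
    have "norm x \<le> (\<Sum>k. norm (f (r k)))" unfolding x_def by (rule summable_norm[OF sn])
    also have "\<dots> \<le> c * norm y * (1 / (1 - 1/2))"
      using suminf_le[OF fb sn sums_summable[OF geo]] sums_unique[OF geo] by simp
    finally have xn: "norm x \<le> (2 * c) * norm y" by simp
    have "(\<lambda>k. A (f (r k))) sums A x" "x \<in> K"
      using bounded_op_sums[OF K A _ xs] f(1)[OF rL] by auto
    moreover have "(\<lambda>k. A (f (r k))) sums y"
    proof -
      have "(\<lambda>k. norm y * (1/2::real) ^ k) \<longlonglongrightarrow> norm y * 0"
        by (intro tendsto_intros LIMSEQ_realpow_zero) auto
      then have "r \<longlonglongrightarrow> 0"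
        using rn by (intro Lim_null_comparison[where f = r]) (auto intro: always_eventually)
      then have "(\<lambda>k. r k - r (Suc k)) sums (r 0 - 0)" by (rule telescope_sums')
      then show ?thesis by (simp add: rS r0)
    qed
    ultimately show ?thesis using xn sums_unique2 by blast
  qed
  then show ?thesis using that[of "2 * c"] c(1) by auto
qed


section \<open>Intertwiners of Cowen--Douglas operators of rank one\<close>

lemma cowen_douglasD:
  assumes "cowen_douglas 1 \<Omega> K T"
  shows "closed_csubspace K" "bounded_op K K T"
    "w \<in> \<Omega> \<Longrightarrow> (\<lambda>x. T x - w *\<^sub>C x) ` K = K"
    "closure (cspan (\<Union>w\<in>\<Omega>. eigenspace K T w)) = K"
    "w \<in> \<Omega> \<Longrightarrow> cdim (eigenspace K T w) = 1"
  using assms unfolding cowen_douglas_def by auto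

lemma eigenspace_spanned:
  assumes "cdim (eigenspace K T w) = 1"
    "v \<in> eigenspace K T w" "v \<noteq> 0" "x \<in> eigenspace K T w"
  obtains c where "x = c *\<^sub>C v"
proof -
  obtain B where B: "eigenspace K T w \<subseteq> cspan B" "card B = 1"
    using complex_vector.basis_exists[of "eigenspace K T w"] assms(1) by metis
  then obtain b where b: "B = {b}" by (auto simp: card_1_singleton_iff)
  obtain d where d: "v = d *\<^sub>C b"
    using B(1) assms(2) b by (auto simp: complex_vector.span_singleton)
  obtain e where e: "x = e *\<^sub>C b"
    using B(1) assms(4) b by (auto simp: complex_vector.span_singleton)
  have "d \<noteq> 0" using d assms(3) by auto
  then have "x = (e / d) *\<^sub>C v" by (simp add: d e)
  then show ?thesis by (rule that)
qed

lemma eigenspace_nonzero: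
  assumes "cdim (eigenspace K T w) = 1"
  obtains v where "v \<in> eigenspace K T w" "v \<noteq> 0"
proof -
  have "\<not> eigenspace K T w \<subseteq> {0}"
  proof
    assume "eigenspace K T w \<subseteq> {0}"
    then have "cspan (eigenspace K T w) = cspan {}"
      by (metis complex_vector.span_empty complex_vector.span_insert_0 subset_singleton_iff)
    then have "cdim (eigenspace K T w) = card ({} :: 'a set)"
      by (intro complex_vector.dim_eq_card[OF _ complex_vector.independent_empty]) simp
    then show False using assms by simp
  qed
  then show ?thesis using that by blast
qed

text \<open>Over an empty \<open>\<Omega>\<close>, which counts as connected, the eigenvectors span
  only zero.\<close>

lemma cowen_douglas_domain_nonempty:
  assumes "cowen_douglas 1 \<Omega> K T" "x \<in> K" "x \<noteq> 0"
  shows "\<Omega> \<noteq> {}"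
  using cowen_douglasD(4)[OF assms(1)] assms(2,3) by auto

lemma cowen_douglas_nontrivial:
  assumes "cowen_douglas 1 \<Omega> K T" "\<Omega> \<noteq> {}"
  obtains x where "x \<in> K" "x \<noteq> 0"
proof -
  obtain w where "w \<in> \<Omega>" using assms(2) by blast
  then obtain v where "v \<in> eigenspace K T w" "v \<noteq> 0"
    using eigenspace_nonzero[OF cowen_douglasD(5)[OF assms(1)]] by blast
  then show ?thesis using that[of v] by (simp add: eigenspace_def)
qed

text \<open>If \<open>\<gamma>\<^sub>0\<close> spans the kernel of \<open>T - w\<^sub>0\<close> and \<open>(T - w\<^sub>0) \<gamma>\<^sub>k\<^sub>+\<^sub>1 = \<gamma>\<^sub>k\<close> with
  \<open>\<parallel>\<gamma>\<^sub>k\<parallel> \<le> C\<^sup>k \<parallel>\<gamma>\<^sub>0\<parallel>\<close>, then \<open>\<Sum>k. (w - w\<^sub>0)\<^sup>k \<gamma>\<^sub>k\<close> is a section of eigenvectors near \<open>w\<^sub>0\<close>.\<close>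

lemma holomorphic_eigenvectors:
  assumes T: "cowen_douglas 1 \<Omega> K T" and w0: "w0 \<in> \<Omega>" and v: "v \<in> eigenspace K T w0"
  obtains r \<gamma> where "r > 0" "\<gamma> w0 = v" "\<And>w. w \<in> ball w0 r \<Longrightarrow> \<gamma> w \<in> eigenspace K T w"
    "\<And>g. bounded_op K UNIV g \<Longrightarrow> (\<lambda>w. g (\<gamma> w)) holomorphic_on ball w0 r"
proof -
  note K = cowen_douglasD(1)[OF T] and bT = cowen_douglasD(2)[OF T]
  let ?N = "\<lambda>x. T x - w0 *\<^sub>C x"
  have bN: "bounded_op K K ?N" by (rule bounded_op_diff_scaleC[OF K bT])
  obtain C where C: "C > 0" "\<And>y. y \<in> K \<Longrightarrow> \<exists>x\<in>K. ?N x = y \<and> norm x \<le> C * norm y"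
    using surj_bounded_op_bounded_preimage[OF K K bN cowen_douglasD(3)[OF T w0]] by metis
  then obtain R where R: "\<And>y. y \<in> K \<Longrightarrow> R y \<in> K" "\<And>y. y \<in> K \<Longrightarrow> ?N (R y) = y"
    "\<And>y. y \<in> K \<Longrightarrow> norm (R y) \<le> C * norm y" by metis
  have vK: "v \<in> K" "?N v = 0" using v by (auto simp: eigenspace_def)
  define a where "a k = (R ^^ k) v" for k
  have aK: "a k \<in> K" for k by (induction k) (auto simp: a_def vK R)
  have Na: "?N (a (Suc k)) = a k" for k using R(2)[OF aK[of k]] by (simp add: a_def)
  have an: "norm (a k) \<le> C ^ k * norm v" for k
  proof (induction k)
    case (Suc k)
    have "norm (a (Suc k)) \<le> C * norm (a k)" using R(3)[OF aK[of k]] by (simp add: a_def)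
    also have "\<dots> \<le> C * (C ^ k * norm v)" using Suc C by (simp add: mult_left_mono)
    finally show ?case by (simp add: mult.assoc)
  qed (simp add: a_def)
  define r where "r = 1 / C"
  define \<gamma> where "\<gamma> w = (\<Sum>k. (w - w0) ^ k *\<^sub>C a k)" for w
  have r: "r > 0" using C by (simp add: r_def)
  have sums: "(\<lambda>k. (w - w0) ^ k *\<^sub>C a k) sums \<gamma> w" if w: "w \<in> ball w0 r" for w
  proof -
    have "cmod (w - w0) * C < 1"
      using w C(1) by (simp add: r_def dist_norm norm_minus_commute field_simps)
    then have "summable (\<lambda>k. (cmod (w - w0) * C) ^ k * norm v)"
      using C(1) by (intro summable_mult2 summable_geometric) simp
    moreover have "norm ((w - w0) ^ k *\<^sub>C a k) \<le> (cmod (w - w0) * C) ^ k * norm v" for k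
      using mult_left_mono[OF an[of k], of "cmod (w - w0) ^ k"]
      by (simp add: norm_scaleC norm_power power_mult_distrib mult.assoc)
    ultimately have "summable (\<lambda>k. (w - w0) ^ k *\<^sub>C a k)"
      by (rule summable_comparison_test'[of _ 0])
    then show ?thesis unfolding \<gamma>_def by (rule summable_sums)
  qed
  have termK: "(w - w0) ^ k *\<^sub>C a k \<in> K" for w k by (rule closed_csubspaceD(4)[OF K aK])
  have "\<gamma> w \<in> eigenspace K T w" if w: "w \<in> ball w0 r" for w
  proof -
    have \<gamma>K: "\<gamma> w \<in> K" by (rule bounded_op_sums(1)[OF K bN termK sums[OF w]])
    have "(\<lambda>k. ?N ((w - w0) ^ k *\<^sub>C a k)) sums ?N (\<gamma> w)"
      by (rule bounded_op_sums(2)[OF K bN termK sums[OF w]])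
    moreover have "?N ((w - w0) ^ k *\<^sub>C a k) = (w - w0) ^ k *\<^sub>C ?N (a k)" for k
      by (rule bounded_opD(3)[OF bN aK])
    ultimately have "(\<lambda>k. (w - w0) ^ k *\<^sub>C ?N (a k)) sums ?N (\<gamma> w)" by simp
    moreover have "?N (a 0) = 0" using vK by (simp add: a_def)
    \<comment> \<open>The term \<open>k = 0\<close> lies in the kernel of \<open>?N\<close>;
      dropping it shifts the index, so that \<open>?N\<close> acts on the series as multiplication
      by \<open>w - w0\<close>.\<close>
    ultimately have "(\<lambda>k. (w - w0) ^ Suc k *\<^sub>C ?N (a (Suc k))) sums ?N (\<gamma> w)"
      by (subst sums_Suc_iff) simp
    then have "(\<lambda>k. (w - w0) ^ Suc k *\<^sub>C a k) sums ?N (\<gamma> w)" by (simp only: Na)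
    moreover have "(\<lambda>k. (w - w0) *\<^sub>C (w - w0) ^ k *\<^sub>C a k) sums ((w - w0) *\<^sub>C \<gamma> w)"
    proof (rule bounded_op_sums(2)[OF K _ termK sums[OF w]])
      show "bounded_op K K ((*\<^sub>C) (w - w0))"
        by (rule bounded_opI[where C = "cmod (w - w0)"])
          (auto simp: closed_csubspaceD[OF K] norm_scaleC complex_vector.scale_right_distrib
            complex_vector.scale_left_commute)
    qed
    ultimately have "?N (\<gamma> w) = (w - w0) *\<^sub>C \<gamma> w" by (simp add: sums_unique2)
    then show ?thesis using \<gamma>K by (simp add: eigenspace_def complex_vector.scale_left_diff_distrib)
  qed
  \<comment> \<open>Holomorphy is meant weakly: each bounded functional turns the series into a
    scalar power series.\<close>
  moreover have "(\<lambda>w. g (\<gamma> w)) holomorphic_on ball w0 r" if g: "bounded_op K (UNIV :: complex set) g" for g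
  proof (rule power_series_holomorphic)
    fix w assume w: "w \<in> ball w0 r"
    have "(\<lambda>k. g ((w - w0) ^ k *\<^sub>C a k)) sums g (\<gamma> w)"
      by (rule bounded_op_sums(2)[OF K g termK sums[OF w]])
    then show "(\<lambda>k. g (a k) * (w - w0) ^ k) sums g (\<gamma> w)"
      by (simp add: bounded_opD(3)[OF g aK] scaleC_complex_def mult.commute)
  qed
  moreover have "\<gamma> w0 = v"
  proof -
    have "(\<lambda>k. (w0 - w0) ^ k *\<^sub>C a k) = (\<lambda>k. if k = 0 then v else 0)"
      by (auto simp: a_def power_0_left)
    then have "(\<lambda>k. (w0 - w0) ^ k *\<^sub>C a k) sums v" using sums_single[of 0 "\<lambda>_. v"] by simp
    then show ?thesis using sums[of w0] r sums_unique2 by (metis centre_in_ball)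
  qed
  ultimately show ?thesis using that r by blast
qed

section \<open>Unique continuation along families of eigenvectors\<close>

lemma eigenvector_persists:
  assumes T: "cowen_douglas 1 \<Omega> K T" and "open \<Omega>" and A: "bounded_op K L A"
    and w0: "w0 \<in> \<Omega>" and v: "v \<in> eigenspace K T w0" "A v \<noteq> 0"
  obtains r \<gamma> where "r > 0" "ball w0 r \<subseteq> \<Omega>"
    "\<And>w. w \<in> ball w0 r \<Longrightarrow> \<gamma> w \<in> eigenspace K T w \<and> A (\<gamma> w) \<noteq> 0"
    "\<And>g. bounded_op K UNIV g \<Longrightarrow> (\<lambda>w. g (\<gamma> w)) holomorphic_on ball w0 r"
proof -
  obtain r \<gamma> where r: "r > 0" and \<gamma>: "\<gamma> w0 = v" "\<And>w. w \<in> ball w0 r \<Longrightarrow> \<gamma> w \<in> eigenspace K T w"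
    and hol: "\<And>g. bounded_op K UNIV g \<Longrightarrow> (\<lambda>w. g (\<gamma> w)) holomorphic_on ball w0 r"
    using holomorphic_eigenvectors[OF T w0 v(1)] by metis
  \<comment> \<open>Pairing with the fixed vector \<open>A v\<close> gives a continuous scalar
    function that is nonzero at \<open>w0\<close>, hence on a smaller ball.\<close>
  let ?f = "\<lambda>w. cinner (A (\<gamma> w)) (A v)"
  have "continuous_on (ball w0 r) ?f"
    by (rule holomorphic_on_imp_continuous_on[OF hol[OF cinner_bounded_op[OF A]]])
  moreover have "?f w0 \<noteq> 0" using v(2) \<gamma> by simp
  ultimately obtain e where e: "e > 0" "\<And>y. y \<in> ball w0 r \<Longrightarrow> dist w0 y < e \<Longrightarrow> ?f y \<noteq> 0"
    using continuous_on_avoid[of "ball w0 r" ?f w0 0] r by (metis centre_in_ball)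
  obtain d where d: "d > 0" "ball w0 d \<subseteq> \<Omega>" using assms(2) w0 openE by metis
  show ?thesis
  proof (rule that)
    show "min r (min d e) > 0" using r d e by simp
    show "ball w0 (min r (min d e)) \<subseteq> \<Omega>" using d by auto
    show "\<gamma> w \<in> eigenspace K T w \<and> A (\<gamma> w) \<noteq> 0" if "w \<in> ball w0 (min r (min d e))" for w
      using e(2)[of w] \<gamma>(2)[of w] that by auto
    show "(\<lambda>w. g (\<gamma> w)) holomorphic_on ball w0 (min r (min d e))" if "bounded_op K UNIV g" for g
      by (rule holomorphic_on_subset[OF hol[OF that]]) auto
  qed
qed

text \<open>\<open>E\<close> below collects the points near which \<open>g\<close> kills every
  eigenvector. It is open, contains \<open>V\<close>, and is closed in \<open>\<Omega>\<close> by
  the identity theorem, so by connectedness it is all of \<open>\<Omega>\<close>; density of the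
  eigenvector span finishes.\<close>

lemma functional_eq_0_if_eq_0_on_eigenvectors:
  assumes T: "cowen_douglas 1 \<Omega> K T" and \<Omega>: "open \<Omega>" "connected \<Omega>"
    and g: "bounded_op K (UNIV :: complex set) g"
    and V: "open V" "V \<noteq> {}" "V \<subseteq> \<Omega>"
    and g0: "\<And>w x. w \<in> V \<Longrightarrow> x \<in> eigenspace K T w \<Longrightarrow> g x = 0" and x: "x \<in> K"
  shows "g x = 0"
proof -
  note K = cowen_douglasD(1)[OF T]
  define E where "E = {w \<in> \<Omega>. \<exists>W. open W \<and> w \<in> W \<and> W \<subseteq> \<Omega> \<and> (\<forall>w'\<in>W. \<forall>x\<in>eigenspace K T w'. g x = 0)}"
  have E_iff: "w \<in> E \<longleftrightarrow> (\<exists>W. open W \<and> w \<in> W \<and> W \<subseteq> \<Omega> \<and> (\<forall>w'\<in>W. \<forall>x\<in>eigenspace K T w'. g x = 0))" for w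
    by (auto simp: E_def)
  have "open E"
    unfolding open_subopen[of E] using E_iff by (metis subsetI)
  moreover have "\<exists>r>0. ball w r \<subseteq> \<Omega> - E" if w: "w \<in> \<Omega> - E" for w
  proof -
    obtain v where v: "v \<in> eigenspace K T w" "v \<noteq> 0"
      using eigenspace_nonzero cowen_douglasD(5)[OF T] w by blast
    have id: "bounded_op K K (\<lambda>x. x)" by (rule bounded_opI[where C = 1]) auto
    obtain r \<gamma> where r: "r > 0" "ball w r \<subseteq> \<Omega>"
      and \<gamma>: "\<And>z. z \<in> ball w r \<Longrightarrow> \<gamma> z \<in> eigenspace K T z \<and> \<gamma> z \<noteq> 0"
      and hol: "(\<lambda>z. g (\<gamma> z)) holomorphic_on ball w r"
      using eigenvector_persists[OF T \<Omega>(1) id _ v] w g by (metis DiffD1)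
    have "ball w r \<inter> E = {}"
    proof (rule ccontr)
      assume "ball w r \<inter> E \<noteq> {}"
      then obtain u W where u: "u \<in> ball w r" "open W" "u \<in> W"
        "\<forall>w'\<in>W. \<forall>x\<in>eigenspace K T w'. g x = 0" using E_iff by blast
      have "g (\<gamma> z) = 0" if "z \<in> ball w r" for z
      proof (rule analytic_continuation_open[where s = "ball w r \<inter> W" and s' = "ball w r"
            and f = "\<lambda>z. g (\<gamma> z)" and g = "\<lambda>_. 0"])
        show "ball w r \<inter> W \<noteq> {}" using u by blast
      qed (use u \<gamma> hol that in auto)
      \<comment> \<open>Eigenspaces are lines, so vanishing on the section \<open>\<gamma>\<close>
        means vanishing on all eigenvectors over the ball.\<close>
      moreover have "\<exists>c. x = c *\<^sub>C \<gamma> z" if "z \<in> ball w r" "x \<in> eigenspace K T z" for x z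
        using eigenspace_spanned[OF cowen_douglasD(5)[OF T], of z "\<gamma> z" x] \<gamma>[OF that(1)] that r
        by blast
      ultimately have "g x = 0" if "z \<in> ball w r" "x \<in> eigenspace K T z" for x z
        using that \<gamma>[OF that(1)] bounded_opD(3)[OF g, of "\<gamma> z"]
        by (fastforce simp: eigenspace_def scaleC_complex_def)
      then have "w \<in> E" unfolding E_iff using r by (intro exI[of _ "ball w r"]) auto
      then show False using w by blast
    qed
    then show ?thesis using r by blast
  qed
  then have "open (\<Omega> - E)" unfolding open_contains_ball by blast
  moreover have "V \<subseteq> E" unfolding E_def using V g0 by blast
  ultimately have "\<Omega> \<subseteq> E"
    using connectedD[OF \<Omega>(2), of E "\<Omega> - E"] V by blast
  then have eig: "g x = 0" if "w \<in> \<Omega>" "x \<in> eigenspace K T w" for w x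
    using that unfolding E_def by blast
  \<comment> \<open>Membership in \<open>K\<close> is carried along because \<open>g\<close> is
    linear only there.\<close>
  have span: "x \<in> K \<and> g x = 0" if "x \<in> cspan (\<Union>w\<in>\<Omega>. eigenspace K T w)" for x
    using that
  proof (induction rule: complex_vector.span_induct_alt)
    case base
    show ?case using closed_csubspaceD(1)[OF K] bounded_op_0[OF K g] by simp
  next
    case (step c y z)
    then show ?case using eig bounded_opD(2,3)[OF g] closed_csubspaceD[OF K]
      by (auto simp: eigenspace_def scaleC_complex_def)
  qed
  obtain s where s: "\<And>n. s n \<in> cspan (\<Union>w\<in>\<Omega>. eigenspace K T w)" "s \<longlonglongrightarrow> x"
    using x cowen_douglasD(4)[OF T] closure_sequential by metis
  obtain C where C: "C > 0" "\<And>x. x \<in> K \<Longrightarrow> norm (g x) \<le> C * norm x"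
    using bounded_op_bound[OF g] by metis
  have "norm (g x) \<le> C * norm (x - s n)" for n
    using C(2)[of "x - s n"] closed_csubspaceD(3)[OF K x] span[OF s(1)] bounded_op_diff[OF K g x] 
    by (metis diff_zero)
  moreover have "(\<lambda>n. C * norm (x - s n)) \<longlonglongrightarrow> C * norm (x - x)"
    using s(2) by (intro tendsto_intros)
  ultimately have "norm (g x) \<le> C * norm (x - x)"
    by (intro LIMSEQ_le_const) auto
  then show ?thesis by simp
qed

section \<open>Nonzero intertwiners, their compositions, and commutators\<close>

definition intertwiner ::
    "'a::complex_hilbert set \<Rightarrow> 'b::complex_hilbert set \<Rightarrow> ('a \<Rightarrow> 'a) \<Rightarrow> ('b \<Rightarrow> 'b) \<Rightarrow> ('a \<Rightarrow> 'b) \<Rightarrow> bool"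
  where "intertwiner K L A B X \<longleftrightarrow> bounded_op K L X \<and> (\<forall>x\<in>K. X (A x) = B (X x))
    \<and> (\<exists>x\<in>K. X x \<noteq> 0)"

lemma intertwiner_eigenspace:
  assumes "intertwiner K L A B X" "x \<in> eigenspace K A w"
  shows "X x \<in> eigenspace L B w"
proof -
  have X: "bounded_op K L X" "X (A x) = B (X x)" "x \<in> K" "A x = w *\<^sub>C x"
    using assms by (auto simp: intertwiner_def eigenspace_def)
  then show ?thesis
    using bounded_opD(1,3)[OF X(1), of x] by (simp add: eigenspace_def)
qed

text \<open>Unique continuation, applied to the functional that pairs \<open>X\<close> with
  \<open>X x\<close>. An arbitrary \<open>V\<close> lets the eigenvector be found where another
  operator is already known to be nonzero.\<close>

lemma bounded_op_nonzero_on_eigenspace: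
  assumes T: "cowen_douglas 1 \<Omega> K T" and \<Omega>: "open \<Omega>" "connected \<Omega>"
    and X: "bounded_op K L X" and x: "x \<in> K" "X x \<noteq> 0"
    and V: "open V" "V \<noteq> {}" "V \<subseteq> \<Omega>"
  obtains w v where "w \<in> V" "v \<in> eigenspace K T w" "X v \<noteq> 0"
proof -
  have "cinner (X x) (X x) \<noteq> 0" using x by simp
  then have "\<exists>w v. w \<in> V \<and> v \<in> eigenspace K T w \<and> cinner (X v) (X x) \<noteq> 0"
    using functional_eq_0_if_eq_0_on_eigenvectors[OF T \<Omega> cinner_bounded_op[OF X, of "X x"] V _ x(1)]
    by blast
  then show ?thesis using that cinner_zero_left by metis
qed

text \<open>Over a whole ball \<open>X\<close> sends a section to nonzero vectors in the eigenlines
  of \<open>B\<close>. Somewhere in that ball \<open>Y\<close> is nonzero on an eigenline, hence on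
  the image of the section.\<close>

lemma intertwiner_compose:
  assumes A: "cowen_douglas 1 \<Omega> K A" and B: "cowen_douglas 1 \<Omega> L B"
    and \<Omega>: "open \<Omega>" "connected \<Omega>"
    and X: "intertwiner K L A B X" and Y: "intertwiner L M B C Y"
  shows "intertwiner K M A C (\<lambda>x. Y (X x))"
proof -
  have bX: "bounded_op K L X" and bY: "bounded_op L M Y"
    using X Y by (auto simp: intertwiner_def)
  obtain x where x: "x \<in> K" "X x \<noteq> 0" using X by (auto simp: intertwiner_def)
  obtain y where y: "y \<in> L" "Y y \<noteq> 0" using Y by (auto simp: intertwiner_def)
  have "x \<noteq> 0" using x bounded_op_0[OF cowen_douglasD(1)[OF A] bX] by auto
  then have "\<Omega> \<noteq> {}" using cowen_douglas_domain_nonempty[OF A x(1)] by blast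
  then obtain w0 v0 where w0: "w0 \<in> \<Omega>" "v0 \<in> eigenspace K A w0" "X v0 \<noteq> 0"
    using bounded_op_nonzero_on_eigenspace[OF A \<Omega> bX x \<Omega>(1)] by blast
  obtain r \<gamma> where r: "r > 0" "ball w0 r \<subseteq> \<Omega>"
    and \<gamma>: "\<And>w. w \<in> ball w0 r \<Longrightarrow> \<gamma> w \<in> eigenspace K A w \<and> X (\<gamma> w) \<noteq> 0"
    using eigenvector_persists[OF A \<Omega>(1) bX w0] by metis
  obtain w v where w: "w \<in> ball w0 r" and v: "v \<in> eigenspace L B w" "Y v \<noteq> 0"
    using bounded_op_nonzero_on_eigenspace[OF B \<Omega> bY y open_ball _ r(2)] r(1) by auto
  have X\<gamma>: "X (\<gamma> w) \<in> eigenspace L B w" "X (\<gamma> w) \<noteq> 0"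
    using intertwiner_eigenspace[OF X] \<gamma>[OF w] by auto
  obtain c where "v = c *\<^sub>C X (\<gamma> w)"
    using eigenspace_spanned[OF cowen_douglasD(5)[OF B] X\<gamma> v(1)] w r by blast
  then have "Y (X (\<gamma> w)) \<noteq> 0"
    using v(2) bounded_opD(3)[OF bY, of "X (\<gamma> w)" c] X\<gamma>(1) by (auto simp: eigenspace_def)
  moreover have "\<gamma> w \<in> K" using \<gamma>[OF w] by (simp add: eigenspace_def)
  ultimately show ?thesis
    using X Y bounded_op_compose[OF bX bY] bounded_opD(1)[OF bX]
    unfolding intertwiner_def by auto
qed

text \<open>A form of the Kleinecke--Shirokov theorem: with \<open>N = T - w\<close> one has
  \<open>N\<^sup>k B\<^sup>k v = k! C\<^sup>k v\<close> for \<open>v\<close> in the kernel of \<open>N\<close>, and the left-hand side grows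
  only geometrically.\<close>

lemma commutator_kills_eigenvector:
  assumes K: "closed_csubspace K" and T: "bounded_op K K T" and B: "bounded_op K K B"
    and C: "bounded_op K K C" and comm: "\<And>x. x \<in> K \<Longrightarrow> T (B x) - B (T x) = C x"
    and CT: "\<And>x. x \<in> K \<Longrightarrow> C (T x) = T (C x)"
    and v: "v \<in> eigenspace K T w" "C v = c *\<^sub>C v"
  shows "C v = 0"
proof (rule ccontr)
  assume Cv: "C v \<noteq> 0"
  define N where "N x = T x - w *\<^sub>C x" for x
  have N: "bounded_op K K N" unfolding N_def by (rule bounded_op_diff_scaleC[OF K T])
  have vK: "v \<in> K" and Nv: "N v = 0" using v by (auto simp: eigenspace_def N_def)
  have NK: "(N ^^ k) x \<in> K" if "x \<in> K" for k x
    using that by (induction k) (auto simp: bounded_opD(1)[OF N])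
  have N0: "(N ^^ k) 0 = 0" for k
    by (induction k) (auto simp: bounded_op_0[OF K N])
  have Nadd: "(N ^^ k) (x + y) = (N ^^ k) x + (N ^^ k) y" if "x \<in> K" "y \<in> K" for k x y
    using that by (induction k) (auto simp: bounded_opD(2)[OF N] NK)
  have BK: "(B ^^ k) v \<in> K" for k by (induction k) (auto simp: bounded_opD(1)[OF B] vK)
  have NB: "N (B x) = B (N x) + C x" if "x \<in> K" for x
  proof -
    have "B (N x) = B (T x) - w *\<^sub>C B x"
      unfolding N_def using bounded_op_diff[OF K B] bounded_opD(3)[OF B that]
        bounded_opD(1)[OF T that] closed_csubspaceD(4)[OF K that] by simp
    then show ?thesis using comm[OF that] by (simp add: N_def algebra_simps)
  qed
  have CN: "C (N x) = N (C x)" if "x \<in> K" for x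
    unfolding N_def using bounded_op_diff[OF K C] bounded_opD(3)[OF C that]
      bounded_opD(1)[OF T that] closed_csubspaceD(4)[OF K that] CT[OF that] by simp
  have CNk: "C ((N ^^ k) x) = (N ^^ k) (C x)" if "x \<in> K" for k x
    by (induction k) (auto simp: CN NK that)
  \<comment> \<open>Leibniz rule: \<open>C\<close> commutes with \<open>N\<close>, so each of the
    \<open>Suc k\<close> factors contributes the same term.\<close>
  have NkB: "(N ^^ Suc k) (B x) = B ((N ^^ Suc k) x) + of_nat (Suc k) *\<^sub>C C ((N ^^ k) x)"
    if x: "x \<in> K" for k x
  proof (induction k)
    case 0
    show ?case using NB[OF x] by (simp add: scaleC_one)
  next
    case (Suc k)
    let ?y = "(N ^^ Suc k) x" and ?z = "C ((N ^^ k) x)"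
    have m: "?y \<in> K" "?z \<in> K" "B ?y \<in> K" "of_nat (Suc k) *\<^sub>C ?z \<in> K"
      using NK[OF x] bounded_opD(1)[OF B] bounded_opD(1)[OF C] closed_csubspaceD(4)[OF K] by blast+
    have "(N ^^ Suc (Suc k)) (B x) = N (B ?y + of_nat (Suc k) *\<^sub>C ?z)"
      using Suc by simp
    also have "\<dots> = N (B ?y) + of_nat (Suc k) *\<^sub>C N ?z"
      by (simp only: bounded_opD(2)[OF N m(3,4)] bounded_opD(3)[OF N m(2)])
    also have "N ?z = C ?y" using CN[OF NK[OF x, of k]] by simp
    also have "N (B ?y) = B (N ?y) + C ?y" by (rule NB[OF m(1)])
    finally have "(N ^^ Suc (Suc k)) (B x) = B (N ?y) + (1 *\<^sub>C C ?y + of_nat (Suc k) *\<^sub>C C ?y)"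
      by (simp only: scaleC_one add.assoc)
    then show ?case by (simp only: scaleC_add_left[symmetric]) simp
  qed
  \<comment> \<open>The second conjunct makes the \<open>B\<close> term of \<open>NkB\<close> vanish
    in the next step.\<close>
  have main: "(N ^^ k) ((B ^^ k) v) = (fact k * c ^ k) *\<^sub>C v \<and> (N ^^ Suc k) ((B ^^ k) v) = 0" for k
  proof (induction k)
    case 0
    show ?case using Nv by (simp add: scaleC_one)
  next
    case (Suc k)
    let ?x = "(B ^^ k) v"
    have IH: "(N ^^ k) ?x = (fact k * c ^ k) *\<^sub>C v" "(N ^^ Suc k) ?x = 0" using Suc by auto
    have "(N ^^ Suc k) (B ?x) = B 0 + of_nat (Suc k) *\<^sub>C C ((fact k * c ^ k) *\<^sub>C v)"
      by (simp only: NkB[OF BK] IH)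
    also have "\<dots> = (fact (Suc k) * c ^ Suc k) *\<^sub>C v"
      by (simp add: bounded_op_0[OF K B] bounded_opD(3)[OF C vK] v(2) scaleC_scaleC algebra_simps)
    finally have 1: "(N ^^ Suc k) (B ?x) = (fact (Suc k) * c ^ Suc k) *\<^sub>C v" .
    have "(N ^^ Suc (Suc k)) (B ?x) = N ((fact (Suc k) * c ^ Suc k) *\<^sub>C v)"
      using 1 by simp
    also have "\<dots> = 0" by (simp only: bounded_opD(3)[OF N vK] Nv complex_vector.scale_zero_right)
    finally show ?case using 1 by simp
  qed
  obtain m where m: "m > 0" "\<And>x. x \<in> K \<Longrightarrow> norm (N x) \<le> m * norm x"
    using bounded_op_bound[OF N] by metis
  obtain b where b: "b > 0" "\<And>x. x \<in> K \<Longrightarrow> norm (B x) \<le> b * norm x"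
    using bounded_op_bound[OF B] by metis
  have Nn: "norm ((N ^^ k) x) \<le> m ^ k * norm x" if "x \<in> K" for k x
  proof (induction k)
    case (Suc k)
    have "norm ((N ^^ Suc k) x) \<le> m * norm ((N ^^ k) x)" using m(2)[OF NK[OF that]] by simp
    also have "\<dots> \<le> m * (m ^ k * norm x)" using Suc m(1) by (simp add: mult_left_mono)
    finally show ?case by (simp add: mult.assoc)
  qed simp
  have Bn: "norm ((B ^^ k) v) \<le> b ^ k * norm v" for k
  proof (induction k)
    case (Suc k)
    have "norm ((B ^^ Suc k) v) \<le> b * norm ((B ^^ k) v)" using b(2)[OF BK] by simp
    also have "\<dots> \<le> b * (b ^ k * norm v)" using Suc b(1) by (simp add: mult_left_mono)
    finally show ?case by (simp add: mult.assoc)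
  qed simp
  have nz: "c \<noteq> 0" "v \<noteq> 0" using Cv v(2) by auto
  have le: "fact k * cmod c ^ k \<le> (m * b) ^ k" for k
  proof -
    have "(fact k * cmod c ^ k) * norm v = norm ((N ^^ k) ((B ^^ k) v))"
      using main[of k] by (simp add: norm_scaleC norm_mult norm_power norm_fact)
    also have "\<dots> \<le> m ^ k * (b ^ k * norm v)"
      using Nn[OF BK, of k k] mult_left_mono[OF Bn[of k], of "m ^ k"] m(1)
      by (meson order_trans zero_le_power less_imp_le)
    finally show ?thesis using nz(2) by (simp add: power_mult_distrib)
  qed
  \<comment> \<open>Dividing \<open>le\<close> by its left-hand side gives terms of an exponential
    series, which tend to zero and yet are at least \<open>1\<close>.\<close>
  have "(\<lambda>k. (m * b / cmod c) ^ k / fact k) \<longlonglongrightarrow> 0" 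
    using summable_LIMSEQ_zero[OF summable_exp[of "m * b / cmod c"]]
    by (simp add: divide_inverse mult.commute)
  moreover have "1 \<le> (m * b / cmod c) ^ k / fact k" for k
    using le[of k] nz(1) by (simp add: power_divide field_simps)
  ultimately have "(1::real) \<le> 0" by (intro LIMSEQ_le_const) auto
  then show False by simp
qed

text \<open>Eigenspaces are lines, so an eigenvector of \<open>T\<close> on which \<open>C\<close>
  is nonzero is also one of \<open>C\<close>, contrary to
  \<open>commutator_kills_eigenvector\<close>.\<close>

lemma commutator_not_intertwiner:
  assumes T: "cowen_douglas 1 \<Omega> K T" and \<Omega>: "open \<Omega>" "connected \<Omega>"
    and B: "bounded_op K K B" and C: "intertwiner K K T T C"
  shows "\<exists>x\<in>K. T (B x) - B (T x) \<noteq> C x"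
proof (rule ccontr)
  assume contr: "\<not> ?thesis"
  have bC: "bounded_op K K C" using C by (simp add: intertwiner_def)
  obtain x where x: "x \<in> K" "C x \<noteq> 0" using C by (auto simp: intertwiner_def)
  have "x \<noteq> 0" using x bounded_op_0[OF cowen_douglasD(1)[OF T] bC] by auto
  then have "\<Omega> \<noteq> {}" using cowen_douglas_domain_nonempty[OF T x(1)] by blast
  then obtain w v where w: "w \<in> \<Omega>" "v \<in> eigenspace K T w" "C v \<noteq> 0"
    using bounded_op_nonzero_on_eigenspace[OF T \<Omega> bC x \<Omega>(1)] by blast
  have "v \<noteq> 0" using w bounded_op_0[OF cowen_douglasD(1)[OF T] bC] by auto
  then obtain c where "C v = c *\<^sub>C v"
    using eigenspace_spanned[OF cowen_douglasD(5)[OF T w(1)] w(2)]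
      intertwiner_eigenspace[OF C w(2)] by metis
  then have "C v = 0"
    using commutator_kills_eigenvector[OF cowen_douglasD(1,2)[OF T] B bC _ _ w(2)] contr C
    by (metis intertwiner_def)
  then show False using w(3) by contradiction
qed


section \<open>Components in an orthogonal direct sum\<close>

text \<open>In an orthogonal direct sum the chosen decomposition is unique at indices below
  \<open>n\<close>; at other indices the value is arbitrary.\<close>

definition component :: "nat \<Rightarrow> (nat \<Rightarrow> 'a::complex_hilbert set) \<Rightarrow> nat \<Rightarrow> 'a \<Rightarrow> 'a"
  where "component n H i x = (SOME h. (\<forall>i<n. h i \<in> H i) \<and> x = (\<Sum>i<n. h i)) i"

context
  fixes n :: nat and H :: "nat \<Rightarrow> 'a::complex_hilbert set"
  assumes sum: "orthogonal_direct_sum n H"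
begin

lemma summand: "i < n \<Longrightarrow> closed_csubspace (H i)"
  and orthogonal: "\<lbrakk>i < n; j < n; i \<noteq> j; x \<in> H i; y \<in> H j\<rbrakk> \<Longrightarrow> cinner x y = 0"
  using sum by (auto simp: orthogonal_direct_sum_def)

lemma component_mem: "i < n \<Longrightarrow> component n H i x \<in> H i"
  and sum_component: "(\<Sum>i<n. component n H i x) = x"
proof -
  have "\<exists>h. (\<forall>i<n. h i \<in> H i) \<and> x = (\<Sum>i<n. h i)"
    using sum by (auto simp: orthogonal_direct_sum_def)
  from someI_ex[OF this] show "i < n \<Longrightarrow> component n H i x \<in> H i"
    "(\<Sum>i<n. component n H i x) = x" by (auto simp: component_def)
qed

lemma cinner_sum_orthogonal:
  assumes "\<And>i. i < n \<Longrightarrow> f i \<in> H i" "\<And>i. i < n \<Longrightarrow> g i \<in> H i"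
  shows "cinner (\<Sum>i<n. f i) (\<Sum>i<n. g i) = (\<Sum>i<n. cinner (f i) (g i))"
proof -
  have "(\<Sum>i<n. \<Sum>j<n. cinner (f j) (g i)) = (\<Sum>i<n. \<Sum>j<n. if j = i then cinner (f i) (g i) else 0)"
    using assms by (intro sum.cong) (auto simp: orthogonal)
  then show ?thesis by (simp add: cinner_sum_left cinner_sum_right)
qed

lemma cinner_eq_sum_component:
  "cinner x y = (\<Sum>i<n. cinner (component n H i x) (component n H i y))"
  using cinner_sum_orthogonal[of "\<lambda>i. component n H i x" "\<lambda>i. component n H i y"]
  by (simp add: component_mem sum_component)

text \<open>The difference of two decompositions sums to zero, and by Pythagoras all its pieces
  vanish.\<close>

lemma component_unique:
  assumes "\<And>i. i < n \<Longrightarrow> f i \<in> H i" "i < n"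
  shows "component n H i (\<Sum>i<n. f i) = f i"
proof -
  let ?d = "\<lambda>i. component n H i (\<Sum>i<n. f i) - f i"
  have d: "?d i \<in> H i" if "i < n" for i
    using that assms(1) by (intro closed_csubspaceD(3) summand component_mem)
  have "(\<Sum>i<n. ?d i) = 0" by (simp add: sum_subtractf sum_component)
  then have "(\<Sum>i<n. cinner (?d i) (?d i)) = 0"
    using cinner_sum_orthogonal[of ?d ?d] d by simp
  then have "(\<Sum>i<n. (norm (?d i))\<^sup>2) = 0"
    by (simp only: cinner_self of_real_sum[symmetric] of_real_eq_0_iff)
  then have "(norm (?d i))\<^sup>2 = 0"
    using assms(2) by (subst (asm) sum_nonneg_eq_0_iff) auto
  then show ?thesis by simp
qed

lemma component_same: "i < n \<Longrightarrow> x \<in> H i \<Longrightarrow> component n H i x = x"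
  and component_other: "i < n \<Longrightarrow> j < n \<Longrightarrow> i \<noteq> j \<Longrightarrow> x \<in> H i \<Longrightarrow> component n H j x = 0"
proof -
  have *: "component n H j x = (if j = i then x else 0)" if "i < n" "x \<in> H i" "j < n" for i j
    using component_unique[of "\<lambda>j. if j = i then x else 0" j] that closed_csubspaceD(1)[OF summand]
    by (simp split: if_splits)
  show "i < n \<Longrightarrow> x \<in> H i \<Longrightarrow> component n H i x = x"
    "i < n \<Longrightarrow> j < n \<Longrightarrow> i \<noteq> j \<Longrightarrow> x \<in> H i \<Longrightarrow> component n H j x = 0"
    using *[of i i] *[of i j] by auto
qed

lemma bounded_op_component:
  assumes "i < n"
  shows "bounded_op UNIV (H i) (component n H i)"
proof (rule bounded_opI[where C = 1])
  fix x y :: 'a and c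
  let ?c = "\<lambda>x i. component n H i x"
  show "?c x i \<in> H i" using assms by (rule component_mem)
  have "x + y = (\<Sum>i<n. ?c x i + ?c y i)" by (simp add: sum.distrib sum_component)
  then show "?c (x + y) i = ?c x i + ?c y i"
    using component_unique[of "\<lambda>i. ?c x i + ?c y i" i] assms
    by (simp add: closed_csubspaceD(2)[OF summand] component_mem)
  have "c *\<^sub>C x = (\<Sum>i<n. c *\<^sub>C ?c x i)"
    by (simp add: complex_vector.scale_sum_right[symmetric] sum_component)
  then show "?c (c *\<^sub>C x) i = c *\<^sub>C ?c x i"
    using component_unique[of "\<lambda>i. c *\<^sub>C ?c x i" i] assms
    by (simp add: closed_csubspaceD(4)[OF summand] component_mem)
  have "(norm (?c x i))\<^sup>2 \<le> (\<Sum>i<n. (norm (?c x i))\<^sup>2)"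
    using assms by (intro member_le_sum) auto
  also have "\<dots> = (norm x)\<^sup>2"
    using cinner_eq_sum_component[of x x]
    by (simp only: cinner_self of_real_sum[symmetric] of_real_eq_iff)
  finally show "norm (?c x i) \<le> 1 * norm x" by simp
qed

lemma bounded_op_eq_if_eq_on_summands:
  assumes "bounded_op UNIV UNIV A" "bounded_op UNIV UNIV B"
    and "\<And>i x. i < n \<Longrightarrow> x \<in> H i \<Longrightarrow> A x = B x"
  shows "A x = B x"
proof -
  have "A (\<Sum>i<n. component n H i x) = B (\<Sum>i<n. component n H i x)"
    using assms(3) component_mem
    by (simp add: bounded_op_sum[OF closed_csubspace_UNIV assms(1)]
        bounded_op_sum[OF closed_csubspace_UNIV assms(2)])
  then show ?thesis by (simp add: sum_component)
qed

end

lemma bounded_op_restrict: "bounded_op UNIV L A \<Longrightarrow> bounded_op K L A"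
  unfolding bounded_op_def clinear_on_def by blast

lemma unitary_op_norm: "unitary_op K L U \<Longrightarrow> x \<in> K \<Longrightarrow> norm (U x) = norm x"
  by (simp add: unitary_op_def norm_eq_sqrt_inner Re_cinner[symmetric])

lemma unitary_op_bounded: "unitary_op K L U \<Longrightarrow> bounded_op K L U"
  using unitary_op_norm[of K L U] unfolding unitary_op_def bounded_op_def
  by (metis mult_1 order_refl)

section \<open>Operators with a flag structure\<close>

abbreviation flag_matrix ::
    "(nat \<Rightarrow> 'a \<Rightarrow> 'a) \<Rightarrow> (nat \<Rightarrow> nat \<Rightarrow> 'a \<Rightarrow> 'a) \<Rightarrow> nat \<Rightarrow> nat \<Rightarrow> 'a \<Rightarrow> 'a::complex_hilbert"
  where "flag_matrix D S \<equiv> \<lambda>i j. if i = j then D i else if i < j then S i j else (\<lambda>x. 0)"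

locale flag_operator =
  fixes \<Omega> :: "complex set" and n :: nat and H :: "nat \<Rightarrow> 'a::complex_hilbert set"
    and T :: "'a \<Rightarrow> 'a" and D :: "nat \<Rightarrow> 'a \<Rightarrow> 'a" and S :: "nat \<Rightarrow> nat \<Rightarrow> 'a \<Rightarrow> 'a"
  assumes domain: "open \<Omega>" "connected \<Omega>" and FB: "FB_class n \<Omega> H T D S"
begin

lemma bounded_T: "bounded_op UNIV UNIV T"
  and direct_sum: "orthogonal_direct_sum n H"
  and rank_one: "i < n \<Longrightarrow> cowen_douglas 1 \<Omega> (H i) (D i)"
  using FB by (auto simp: FB_class_def)

lemma bounded_entry: "i < n \<Longrightarrow> j < n \<Longrightarrow> bounded_op (H j) (H i) (flag_matrix D S i j)"
  and T_eq_column_sum: "j < n \<Longrightarrow> x \<in> H j \<Longrightarrow> T x = (\<Sum>i<n. flag_matrix D S i j x)"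
  using FB unfolding FB_class_def has_block_matrix_def by blast+

lemma bounded_D: "i < n \<Longrightarrow> bounded_op (H i) (H i) (D i)"
  using bounded_entry[of i i] by simp

lemma bounded_S: "i < j \<Longrightarrow> j < n \<Longrightarrow> bounded_op (H j) (H i) (S i j)"
  using bounded_entry[of i j] by simp

lemma closed_summand: "i < n \<Longrightarrow> closed_csubspace (H i)"
  using summand[OF direct_sum] .

lemma intertwiner_S:
  assumes "Suc i < n"
  shows "intertwiner (H (Suc i)) (H i) (D (Suc i)) (D i) (S i (Suc i))"
  using assms FB bounded_S[of i "Suc i"] by (auto simp: intertwiner_def FB_class_def)

lemma T_column:
  assumes "j < n" "x \<in> H j"
  shows "T x = D j x + (\<Sum>k<j. S k j x)"
proof -
  have "T x = (\<Sum>i\<in>{..<n}. flag_matrix D S i j x)" by (rule T_eq_column_sum[OF assms])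
  also have "\<dots> = (\<Sum>i\<in>{..j}. flag_matrix D S i j x)"
    using assms(1) by (intro sum.mono_neutral_right) auto
  also have "\<dots> = (\<Sum>k<j. S k j x) + D j x"
    by (subst lessThan_Suc_atMost[symmetric], subst sum.lessThan_Suc) simp
  finally show ?thesis by (simp add: add.commute)
qed

lemma component_T:
  assumes i: "i < n"
  shows "component n H i (T x) = D i (component n H i x)
    + (\<Sum>k\<in>{i<..<n}. S i k (component n H k x))"
proof -
  let ?c = "\<lambda>i. component n H i x"
  have c: "?c k \<in> H k" if "k < n" for k using component_mem[OF direct_sum that] .
  note bc = bounded_op_component[OF direct_sum i]
  have "T x = T (\<Sum>k<n. ?c k)" by (simp add: sum_component[OF direct_sum])
  also have "\<dots> = (\<Sum>k<n. T (?c k))"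
    by (rule bounded_op_sum[OF closed_csubspace_UNIV bounded_T]) simp
  finally have "component n H i (T x) = (\<Sum>k<n. component n H i (T (?c k)))"
    by (simp add: bounded_op_sum[OF closed_csubspace_UNIV bc])
  also have "\<dots> = (\<Sum>k<n. flag_matrix D S i k (?c k))"
  proof (rule sum.cong)
    fix k assume "k \<in> {..<n}"
    then have k: "k < n" by simp
    have "component n H i (\<Sum>l<n. flag_matrix D S l k (?c k)) = flag_matrix D S i k (?c k)"
      by (rule component_unique[OF direct_sum _ i]) (rule bounded_opD(1)[OF bounded_entry[OF _ k] c[OF k]])
    then show "component n H i (T (?c k)) = flag_matrix D S i k (?c k)"
      by (simp only: T_eq_column_sum[OF k c[OF k]])
  qed simp
  also have "\<dots> = (\<Sum>k\<in>insert i {i<..<n}. flag_matrix D S i k (?c k))"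
    using i by (intro sum.mono_neutral_right) auto
  also have "\<dots> = D i (?c i) + (\<Sum>k\<in>{i<..<n}. S i k (?c k))"
    by (subst sum.insert) (auto intro!: sum.cong)
  finally show ?thesis .
qed

text \<open>The entries \<open>S k (Suc k)\<close> are nonzero intertwiners towards smaller indices;
  composing with them lowers the target without losing nonvanishing.\<close>

lemma lower_target:
  assumes L: "cowen_douglas 1 \<Omega> L B" and "i \<le> j" "j < n"
    and "\<exists>W. intertwiner L (H j) B (D j) W"
  shows "\<exists>W. intertwiner L (H i) B (D i) W"
  using assms(2-4)
proof (induction rule: inc_induct)
  case (step k)
  then obtain W where "intertwiner L (H (Suc k)) B (D (Suc k)) W" by auto
  from intertwiner_compose[OF L rank_one domain this intertwiner_S] step show ?case by auto
qed

text \<open>The same entries, composed on the other side, let the source be any later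
  summand.\<close>

lemma raise_source:
  assumes "i \<le> j" "j < n" and "\<exists>W. intertwiner (H i) L (D i) B W"
  shows "\<exists>W. intertwiner (H j) L (D j) B W"
  using assms
proof (induction rule: dec_induct)
  case (step k)
  then obtain W where "intertwiner (H k) L (D k) B W" by auto
  from intertwiner_compose[OF rank_one rank_one domain intertwiner_S this] step show ?case by auto
qed

end

section \<open>Block entries of an operator intertwining two flag operators\<close>

locale flag_intertwining =
  src: flag_operator \<Omega> n H T D S + tgt: flag_operator \<Omega> n H' T' D' S'
  for \<Omega> :: "complex set" and n :: nat
    and H :: "nat \<Rightarrow> 'a::complex_hilbert set" and T D S
    and H' :: "nat \<Rightarrow> 'b::complex_hilbert set" and T' D' S' +
  fixes X :: "'a \<Rightarrow> 'b"
  assumes bounded_X: "bounded_op UNIV UNIV X" and X_T: "X (T x) = T' (X x)"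
begin

text \<open>The operator \<open>M i\<close>, restricted to \<open>H j\<close>, is the entry of \<open>X\<close> in row \<open>i\<close> and column \<open>j\<close>.\<close>

definition M :: "nat \<Rightarrow> 'a \<Rightarrow> 'b"
  where "M i x = component n H' i (X x)"

lemma bounded_M: "i < n \<Longrightarrow> bounded_op K (H' i) (M i)"
  unfolding M_def
  by (rule bounded_op_restrict[OF bounded_op_compose[OF bounded_X bounded_op_component[OF tgt.direct_sum]]])

lemma M_mem: "i < n \<Longrightarrow> M i x \<in> H' i"
  unfolding M_def by (rule component_mem[OF tgt.direct_sum])

lemma sum_M: "(\<Sum>i<n. M i x) = X x"
  unfolding M_def by (rule sum_component[OF tgt.direct_sum])

text \<open>Comparison of the entries of \<open>X T = T' X\<close> in row \<open>i\<close> and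
  column \<open>j\<close>; triangularity leaves only \<open>k < j\<close> on one side and
  \<open>k > i\<close> on the other.\<close>

lemma entry_equation:
  assumes i: "i < n" and j: "j < n" and x: "x \<in> H j"
  shows "M i (D j x) + (\<Sum>k<j. M i (S k j x))
    = D' i (M i x) + (\<Sum>k\<in>{i<..<n}. S' i k (M k x))"
proof -
  have "M i (T x) = M i (D j x) + (\<Sum>k<j. M i (S k j x))"
    unfolding src.T_column[OF j x]
    by (simp add: bounded_opD(2)[OF bounded_M[OF i, of UNIV]]
        bounded_op_sum[OF closed_csubspace_UNIV bounded_M[OF i]])
  moreover have "M i (T x) = D' i (M i x) + (\<Sum>k\<in>{i<..<n}. S' i k (M k x))"
    unfolding M_def X_T by (rule tgt.component_T[OF i])
  ultimately show ?thesis by simp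
qed

lemma S'_M_eq_0: "i < k \<Longrightarrow> k < n \<Longrightarrow> M k x = 0 \<Longrightarrow> S' i k (M k x) = 0"
  using bounded_op_0[OF tgt.closed_summand tgt.bounded_S] by simp

text \<open>The lowest nonzero block of a column, strictly below the diagonal. The required zeros
  delete both off-diagonal sums of \<open>entry_equation\<close>; row \<open>i\<close> is included
  for columns \<open>l < m\<close> because the terms \<open>M i (S l m x)\<close> must
  vanish.\<close>

definition corner :: "nat \<Rightarrow> nat \<Rightarrow> bool"
  where "corner m i \<longleftrightarrow> m < i \<and> i < n \<and> (\<exists>x\<in>H m. M i x \<noteq> 0)
    \<and> (\<forall>k l. i \<le> k \<and> k < n \<and> l < m \<longrightarrow> (\<forall>x\<in>H l. M k x = 0))
    \<and> (\<forall>k. i < k \<and> k < n \<longrightarrow> (\<forall>x\<in>H m. M k x = 0))"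

lemma corner_intertwiner:
  assumes "corner m i"
  shows "intertwiner (H m) (H' i) (D m) (D' i) (M i)"
proof -
  have mi: "m < i" "i < n" "m < n" and nz: "\<exists>x\<in>H m. M i x \<noteq> 0"
    using assms by (auto simp: corner_def)
  have "M i (D m x) = D' i (M i x)" if x: "x \<in> H m" for x
  proof -
    have "M i (S k m x) = 0" if "k < m" for k
      using assms that bounded_opD(1)[OF src.bounded_S x, of k] mi by (auto simp: corner_def)
    moreover have "S' i k (M k x) = 0" if "k \<in> {i<..<n}" for k
      using assms that x by (intro S'_M_eq_0) (auto simp: corner_def)
    ultimately show ?thesis using entry_equation[OF mi(2,3) x] by simp
  qed
  then show ?thesis unfolding intertwiner_def using nz bounded_M[OF mi(2)] by blast
qed

text \<open>One column further, the sum over the source keeps only the term \<open>k = m\<close>,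
  which turns the intertwining relation into a commutator equation.\<close>

lemma corner_commutator:
  assumes c: "corner m i" and next0: "\<And>k x. i < k \<Longrightarrow> k < n \<Longrightarrow> x \<in> H (Suc m) \<Longrightarrow> M k x = 0"
    and x: "x \<in> H (Suc m)"
  shows "D' i (M i x) - M i (D (Suc m) x) = M i (S m (Suc m) x)"
proof -
  have mi: "m < i" "i < n" "Suc m < n" using c by (auto simp: corner_def)
  have "M i (S k (Suc m) x) = 0" if "k < m" for k
    using c that bounded_opD(1)[OF src.bounded_S x, of k] mi by (auto simp: corner_def)
  moreover have "S' i k (M k x) = 0" if "k \<in> {i<..<n}" for k
    using that x next0 by (intro S'_M_eq_0) auto
  ultimately show ?thesis using entry_equation[OF mi(2,3) x] by (simp add: algebra_simps)
qed

text \<open>The lowest nonzero row, \<open>Max ?R\<close>, exceeds \<open>i\<close> and so stays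
  below the diagonal even one column to the right. The zeros to its left come from the old
  corner.\<close>

lemma next_corner:
  assumes c: "corner m i" and "i < k" "k < n" "x \<in> H (Suc m)" "M k x \<noteq> 0"
  shows "\<exists>i'. corner (Suc m) i'"
proof -
  let ?R = "{k. i < k \<and> k < n \<and> (\<exists>x\<in>H (Suc m). M k x \<noteq> 0)}"
  have fin: "finite ?R" by simp
  have "?R \<noteq> {}" using assms by blast
  then have R: "Max ?R \<in> ?R" using Max_in[OF fin] by blast
  have "M k x = 0" if "Max ?R < k" "k < n" "x \<in> H (Suc m)" for k x
  proof (rule ccontr)
    assume "M k x \<noteq> 0"
    then have "k \<in> ?R" using that R by auto
    then show False using Max_ge[OF fin] that(1) by fastforce
  qed
  moreover have "M k x = 0" if "Max ?R \<le> k" "k < n" "l < Suc m" "x \<in> H l" for k l x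
  proof -
    have "i < k" "l < m \<or> l = m" using R that(1,3) by auto
    then show ?thesis using c that(2,4) unfolding corner_def by (meson less_imp_le)
  qed
  moreover have "Suc m < Max ?R" using c R by (auto simp: corner_def)
  ultimately show ?thesis unfolding corner_def using R by blast
qed

text \<open>The rows of the corners strictly increase with the column and stay below \<open>n\<close>, so the sequence
  of corners must break off, and where it does the commutator equation holds.\<close>

lemma corner_break:
  assumes "corner m i"
  obtains j q where "m \<le> j" "corner j q" "\<And>l. m \<le> l \<Longrightarrow> l \<le> j \<Longrightarrow> \<exists>i. corner l i"
    "\<And>x. x \<in> H (Suc j) \<Longrightarrow> D' q (M q x) - M q (D (Suc j) x) = M q (S j (Suc j) x)"
proof -
  \<comment> \<open>The corners in all intermediate columns are recorded, since two break columns
    must later be compared.\<close>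
  have "\<exists>j q. m \<le> j \<and> corner j q \<and> (\<forall>l. m \<le> l \<and> l \<le> j \<longrightarrow> (\<exists>i. corner l i))
    \<and> (\<forall>x\<in>H (Suc j). D' q (M q x) - M q (D (Suc j) x) = M q (S j (Suc j) x))"
    using assms
  proof (induction "n - m" arbitrary: m i rule: less_induct)
    case less
    show ?case
    proof (cases "\<exists>k x. i < k \<and> k < n \<and> x \<in> H (Suc m) \<and> M k x \<noteq> 0")
      case True
      then obtain i' where i': "corner (Suc m) i'" using next_corner[OF less(2)] by blast
      have "n - Suc m < n - m" using less(2) by (auto simp: corner_def)
      from less(1)[OF this i'] obtain j q where jq: "Suc m \<le> j" "corner j q"
        "\<forall>l. Suc m \<le> l \<and> l \<le> j \<longrightarrow> (\<exists>i. corner l i)"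
        "\<forall>x\<in>H (Suc j). D' q (M q x) - M q (D (Suc j) x) = M q (S j (Suc j) x)" by blast
      have "\<forall>l. m \<le> l \<and> l \<le> j \<longrightarrow> (\<exists>i. corner l i)"
        using jq(3) less(2) by (metis le_eq_less_or_eq Suc_leI)
      then show ?thesis using jq by (intro exI[of _ j] exI[of _ q]) auto
    next
      case False
      then have "\<forall>x\<in>H (Suc m). D' i (M i x) - M i (D (Suc m) x) = M i (S m (Suc m) x)"
        using corner_commutator[OF less(2)] by blast
      then show ?thesis using less(2) by (intro exI[of _ m] exI[of _ i]) auto
    qed
  qed
  then show ?thesis using that by blast
qed

text \<open>A nonzero intertwiner from \<open>H' j\<close> back to a later summand closes a cycle: it turns the entry
  of \<open>X\<close> next to the corner into an operator on \<open>H (j + 1)\<close> whose commutator with \<open>D (j + 1)\<close>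
  is a nonzero intertwiner.\<close>

lemma no_return:
  assumes c: "corner j i"
    and comm: "\<And>x. x \<in> H (Suc j) \<Longrightarrow> D' i (M i x) - M i (D (Suc j) x) = M i (S j (Suc j) x)"
    and W: "intertwiner (H' j) (H q) (D' j) (D q) W" and q: "j < q" "q < n"
  shows False
proof -
  have ji: "j < i" "i < n" "j < n" "Suc j < n" using c by (auto simp: corner_def)
  \<comment> \<open>The source is raised from \<open>j\<close> to \<open>i\<close>, then the target
    lowered from \<open>q\<close> to \<open>Suc j\<close>; both are compositions with superdiagonal
    entries.\<close>
  have "\<exists>W. intertwiner (H' i) (H q) (D' i) (D q) W"
    using tgt.raise_source[of j i "H q" "D q"] ji W by auto
  then obtain Z where Z: "intertwiner (H' i) (H (Suc j)) (D' i) (D (Suc j)) Z"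
    using src.lower_target[OF tgt.rank_one[OF ji(2)], of "Suc j" q] q by auto
  have bZ: "bounded_op (H' i) (H (Suc j)) Z"
    and ZD: "\<And>y. y \<in> H' i \<Longrightarrow> Z (D' i y) = D (Suc j) (Z y)"
    using Z by (auto simp: intertwiner_def)
  have cd: "cowen_douglas 1 \<Omega> (H (Suc j)) (D (Suc j))" "cowen_douglas 1 \<Omega> (H j) (D j)"
    "cowen_douglas 1 \<Omega> (H' i) (D' i)"
    using src.rank_one tgt.rank_one ji by auto
  have C: "intertwiner (H (Suc j)) (H (Suc j)) (D (Suc j)) (D (Suc j)) (\<lambda>x. Z (M i (S j (Suc j) x)))"
    by (rule intertwiner_compose[OF cd(1,3) src.domain
          intertwiner_compose[OF cd(1,2) src.domain src.intertwiner_S[OF ji(4)] corner_intertwiner[OF c]] Z])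
  have "D (Suc j) (Z (M i x)) - Z (M i (D (Suc j) x)) = Z (M i (S j (Suc j) x))"
    if x: "x \<in> H (Suc j)" for x
  proof -
    have "Z (D' i (M i x) - M i (D (Suc j) x)) = Z (D' i (M i x)) - Z (M i (D (Suc j) x))"
      by (rule bounded_op_diff[OF tgt.closed_summand bZ])
        (auto intro: ji M_mem bounded_opD(1)[OF tgt.bounded_D])
    then show ?thesis using comm[OF x] ZD[OF M_mem[OF ji(2)]] by simp
  qed
  then show False
    using commutator_not_intertwiner[OF cd(1) src.domain bounded_op_compose[OF bounded_M[OF ji(2)] bZ] C]
    by blast
qed

end

section \<open>Unitary intertwiners are block diagonal\<close>

locale flag_unitary =
  fwd: flag_intertwining \<Omega> n H T D S H' T' D' S' X + bwd: flag_intertwining \<Omega> n H' T' D' S' H T D S Y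
  for \<Omega> :: "complex set" and n :: nat
    and H :: "nat \<Rightarrow> 'a::complex_hilbert set" and T D S
    and H' :: "nat \<Rightarrow> 'b::complex_hilbert set" and T' D' S' X Y +
  assumes Y_X: "Y (X x) = x" and X_Y: "X (Y y) = y"
    and adjoint: "cinner (X x) y = cinner x (Y y)"
begin

text \<open>Exchanging \<open>X\<close> and \<open>Y\<close> makes each result below available for
  both.\<close>

lemma inverse: "flag_unitary \<Omega> n H' T' D' S' H T D S Y X"
proof unfold_locales
  show "cinner (Y y) x = cinner y (X x)" for x y
    by (metis adjoint cinner_commute)
qed (rule Y_X X_Y)+

text \<open>Including \<open>Y\<close> keeps the notion symmetric and, by adjointness, makes rows of
  \<open>X\<close> vanish along with columns.\<close>

definition diagonal_up_to :: "nat \<Rightarrow> bool"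
  where "diagonal_up_to a \<longleftrightarrow> (\<forall>l<a. X ` H l \<subseteq> H' l \<and> Y ` H' l \<subseteq> H l)"

text \<open>Unitarity enters here: by \<open>adjoint\<close>, row \<open>l\<close> of
  \<open>X\<close> is governed by column \<open>l\<close> of its inverse \<open>Y\<close>, which is
  already diagonal.\<close>

lemma diagonal_row:
  assumes "diagonal_up_to a" "l < a" "l < n" "j < n" "j \<noteq> l" "x \<in> H j"
  shows "fwd.M l x = 0"
proof -
  let ?y = "fwd.M l x"
  have y: "?y \<in> H' l" by (rule fwd.M_mem[OF assms(3)])
  have "cinner ?y ?y = (\<Sum>i<n. cinner (fwd.M i x) (if i = l then ?y else 0))"
    using assms(3) by (simp add: if_distrib[of "cinner _"] cong: if_cong)
  also have "\<dots> = cinner (X x) ?y"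
  proof -
    have "component n H' i ?y = (if i = l then ?y else 0)" if "i < n" for i
      using that component_same[OF fwd.tgt.direct_sum assms(3) y]
        component_other[OF fwd.tgt.direct_sum assms(3) that _ y] by auto
    then show ?thesis
      unfolding cinner_eq_sum_component[OF fwd.tgt.direct_sum, of "X x" ?y]
      by (intro sum.cong) (simp_all add: fwd.M_def[of _ x])
  qed
  also have "\<dots> = cinner x (Y ?y)" by (rule adjoint)
  also have "\<dots> = 0"
  proof (rule orthogonal[OF fwd.src.direct_sum assms(4,3,5,6)])
    show "Y ?y \<in> H l" using assms(1,2) y unfolding diagonal_up_to_def by blast
  qed
  finally show ?thesis by simp
qed

lemma diagonal_column:
  assumes "diagonal_up_to a" "l < a" "l < n" "k < n" "k \<noteq> l" "x \<in> H l"
  shows "fwd.M k x = 0"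
  unfolding fwd.M_def using assms
  by (intro component_other[OF fwd.tgt.direct_sum, of l]) (auto simp: diagonal_up_to_def)

text \<open>As in \<open>next_corner\<close>, the lowest nonzero row is taken; the zeros required in
  earlier columns hold because those columns are diagonal.\<close>

lemma first_corner:
  assumes diag: "diagonal_up_to a" and a: "a < i" "i < n" "x \<in> H a" "fwd.M i x \<noteq> 0"
  shows "\<exists>i. fwd.corner a i"
proof -
  let ?R = "{k. a < k \<and> k < n \<and> (\<exists>x\<in>H a. fwd.M k x \<noteq> 0)}"
  have fin: "finite ?R" by simp
  have "?R \<noteq> {}" using a by blast
  then have R: "Max ?R \<in> ?R" using Max_in[OF fin] by blast
  have "fwd.M k x = 0" if "Max ?R < k" "k < n" "x \<in> H a" for k x
  proof (rule ccontr)
    assume "fwd.M k x \<noteq> 0"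
    then have "k \<in> ?R" using that R by auto
    then show False using Max_ge[OF fin] that(1) by fastforce
  qed
  moreover have "fwd.M k x = 0" if "Max ?R \<le> k" "k < n" "l < a" "x \<in> H l" for k l x
    using R that by (intro diagonal_column[OF diag that(3)]) auto
  ultimately show ?thesis unfolding fwd.corner_def using R by blast
qed

text \<open>Rows above \<open>a\<close> vanish by unitarity (\<open>diagonal_row\<close>); a nonzero
  block below would yield a corner.\<close>

lemma maps_summand_if_no_corner:
  assumes diag: "diagonal_up_to a" and a: "a < n" and none: "\<nexists>i. fwd.corner a i" and x: "x \<in> H a"
  shows "X x \<in> H' a"
proof -
  have "fwd.M i x = 0" if "i < n" "i \<noteq> a" for i
    using diagonal_row[OF diag _ that(1) a _ x] first_corner[OF diag _ that(1) x] none that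
    by (metis linorder_neqE_nat)
  then have "(\<Sum>i<n. fwd.M i x) = (\<Sum>i<n. if i = a then fwd.M a x else 0)"
    by (intro sum.cong) auto
  then have "X x = fwd.M a x" using a by (simp add: fwd.sum_M)
  then show ?thesis using fwd.M_mem[OF a] by simp
qed

text \<open>In the earlier of the two break columns the other operator still has a corner, which is
  an intertwiner back to a strictly later summand; \<open>no_return\<close> forbids this.\<close>

lemma no_two_corners:
  assumes "fwd.corner a i" "bwd.corner a i'"
  shows False
proof -
  obtain j q where j: "a \<le> j" "fwd.corner j q" "\<And>l. a \<le> l \<Longrightarrow> l \<le> j \<Longrightarrow> \<exists>i. fwd.corner l i"
    "\<And>x. x \<in> H (Suc j) \<Longrightarrow> D' q (fwd.M q x) - fwd.M q (D (Suc j) x) = fwd.M q (S j (Suc j) x)"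
    using fwd.corner_break[OF assms(1)] by metis
  obtain j' q' where j': "a \<le> j'" "bwd.corner j' q'" "\<And>l. a \<le> l \<Longrightarrow> l \<le> j' \<Longrightarrow> \<exists>i. bwd.corner l i"
    "\<And>x. x \<in> H' (Suc j') \<Longrightarrow> D q' (bwd.M q' x) - bwd.M q' (D' (Suc j') x) = bwd.M q' (S' j' (Suc j') x)"
    using bwd.corner_break[OF assms(2)] by metis
  show False
  proof (cases "j \<le> j'")
    case True
    then obtain p where "bwd.corner j p" using j'(3) j(1) by blast
    then show False
      using fwd.no_return[OF j(2,4) bwd.corner_intertwiner] by (auto simp: bwd.corner_def)
  next
    case False
    then obtain p where "fwd.corner j' p" using j(3) j'(1) by (meson nat_le_linear)
    then show False
      using bwd.no_return[OF j'(2,4) fwd.corner_intertwiner] by (auto simp: fwd.corner_def)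
  qed
qed

text \<open>If only \<open>Y\<close> had a corner, \<open>X\<close> would be a nonzero intertwiner
  from \<open>H a\<close> to \<open>H' a\<close>; followed by the corner it would give a nonzero
  off-diagonal block of \<open>Y X = 1\<close>.\<close>

lemma no_corner_back:
  assumes diag: "diagonal_up_to a" and none: "\<nexists>i. fwd.corner a i"
  shows "\<nexists>i. bwd.corner a i"
proof
  assume "\<exists>i. bwd.corner a i"
  then obtain i where c: "bwd.corner a i" by blast
  have a: "a < i" "i < n" "a < n" using c by (auto simp: bwd.corner_def)
  have X: "X x \<in> H' a" if "x \<in> H a" for x
    using maps_summand_if_no_corner[OF diag a(3) none that] .
  have W: "intertwiner (H' a) (H i) (D' a) (D i) (bwd.M i)"
    by (rule bwd.corner_intertwiner[OF c])
  \<comment> \<open>The nonzero corner forces \<open>\<Omega>\<close> to be nonempty, which in turn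
    provides a nonzero vector in \<open>H a\<close>.\<close>
  obtain y where y: "y \<in> H' a" "bwd.M i y \<noteq> 0" using W by (auto simp: intertwiner_def)
  have "y \<noteq> 0"
    using y bounded_op_0[OF fwd.tgt.closed_summand[OF a(3)] bwd.bounded_M[OF a(2)]] by auto
  then have "\<Omega> \<noteq> {}" using cowen_douglas_domain_nonempty[OF fwd.tgt.rank_one[OF a(3)] y(1)] by blast
  then obtain x where x: "x \<in> H a" "x \<noteq> 0"
    by (rule cowen_douglas_nontrivial[OF fwd.src.rank_one[OF a(3)]])
  have "intertwiner (H a) (H' a) (D a) (D' a) X"
    unfolding intertwiner_def
  proof (intro conjI ballI)
    show "bounded_op (H a) (H' a) X"
      using X fwd.bounded_X by (auto simp: bounded_op_def clinear_on_def)
    show "\<exists>x\<in>H a. X x \<noteq> 0"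
      using x Y_X bounded_op_0[OF closed_csubspace_UNIV bwd.bounded_X] by metis
    fix z assume z: "z \<in> H a"
    have comp: "fwd.M k x = (if k = a then X x else 0)" if "x \<in> H a" "k < n" for k x
      unfolding fwd.M_def using component_same[OF fwd.tgt.direct_sum a(3) X[OF that(1)]]
        component_other[OF fwd.tgt.direct_sum a(3) that(2) _ X[OF that(1)]] by auto
    have "fwd.M a (S k a z) = 0" if "k < a" for k
      using that a bounded_opD(1)[OF fwd.src.bounded_S z, of k]
      by (intro diagonal_column[OF diag that]) auto
    moreover have "S' a k (fwd.M k z) = 0" if "k \<in> {a<..<n}" for k
      using that comp[OF z] by (intro fwd.S'_M_eq_0) auto
    ultimately show "X (D a z) = D' a (X z)"
      using fwd.entry_equation[OF a(3,3) z] comp[OF z a(3)]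
        comp[OF bounded_opD(1)[OF fwd.src.bounded_D[OF a(3)] z] a(3)] by simp
  qed
  from intertwiner_compose[OF fwd.src.rank_one[OF a(3)] fwd.tgt.rank_one[OF a(3)] fwd.src.domain this W]
  obtain z where z: "z \<in> H a" "bwd.M i (X z) \<noteq> 0" by (auto simp: intertwiner_def)
  then show False
    using component_other[OF fwd.src.direct_sum a(3,2) _ z(1)] a(1) by (simp add: bwd.M_def Y_X)
qed

text \<open>In column \<open>a\<close> corners occur for both operators or for neither, and both is
  impossible.\<close>

lemma diagonal_up_to_Suc:
  assumes diag: "diagonal_up_to a" and a: "a < n"
  shows "diagonal_up_to (Suc a)"
proof -
  have diag': "flag_unitary.diagonal_up_to H' H Y X a"
    using diag by (auto simp: diagonal_up_to_def flag_unitary.diagonal_up_to_def[OF inverse])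
  have none: "\<nexists>i. fwd.corner a i" "\<nexists>i. bwd.corner a i"
    using no_corner_back[OF diag] flag_unitary.no_corner_back[OF inverse diag'] no_two_corners
    by blast+
  have "X ` H a \<subseteq> H' a" "Y ` H' a \<subseteq> H a"
    using maps_summand_if_no_corner[OF diag a none(1)]
      flag_unitary.maps_summand_if_no_corner[OF inverse diag' a none(2)] by auto
  then show ?thesis using diag by (auto simp: diagonal_up_to_def less_Suc_eq)
qed

lemma diagonal:
  assumes "i < n"
  shows "X ` H i = H' i"
proof -
  have "diagonal_up_to a" if "a \<le> n" for a
    using that
  proof (induction a)
    case (Suc a)
    then show ?case using diagonal_up_to_Suc[of a] by simp
  qed (simp add: diagonal_up_to_def)
  from this[of n] have "X ` H i \<subseteq> H' i" "Y ` H' i \<subseteq> H i"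
    using assms by (auto simp: diagonal_up_to_def)
  then show ?thesis using X_Y by (metis image_eqI image_subset_iff subsetI subset_antisym)
qed

text \<open>Since \<open>X\<close> maps each summand onto its counterpart, both sides of
  \<open>X (T x) = T' (X x)\<close> come decomposed along \<open>H'\<close>, and components are
  unique.\<close>

lemma entries:
  assumes i: "i < n" and j: "j < n" and x: "x \<in> H j"
  shows "X (flag_matrix D S i j x) = flag_matrix D' S' i j (X x)"
proof -
  have Xx: "X x \<in> H' j" using diagonal[OF j] x by blast
  have "(\<Sum>i<n. X (flag_matrix D S i j x)) = X (T x)"
    unfolding fwd.src.T_eq_column_sum[OF j x]
    by (rule bounded_op_sum[OF closed_csubspace_UNIV fwd.bounded_X, symmetric]) simp
  also have "\<dots> = (\<Sum>i<n. flag_matrix D' S' i j (X x))"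
    unfolding fwd.X_T by (rule fwd.tgt.T_eq_column_sum[OF j Xx])
  finally have eq: "(\<Sum>i<n. X (flag_matrix D S i j x)) = (\<Sum>i<n. flag_matrix D' S' i j (X x))" .
  have "component n H' i (\<Sum>i<n. X (flag_matrix D S i j x)) = X (flag_matrix D S i j x)"
    by (rule component_unique[OF fwd.tgt.direct_sum _ i])
      (use diagonal bounded_opD(1)[OF fwd.src.bounded_entry[OF _ j] x] in blast)
  moreover have "component n H' i (\<Sum>i<n. flag_matrix D' S' i j (X x)) = flag_matrix D' S' i j (X x)"
    by (rule component_unique[OF fwd.tgt.direct_sum _ i])
      (rule bounded_opD(1)[OF fwd.tgt.bounded_entry[OF _ j] Xx])
  ultimately show ?thesis using eq by simp
qed

end

section \<open>The two directions of the equivalence\<close>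

lemma unitary_equivalence_imp_blocks:
  fixes H :: "nat \<Rightarrow> 'a::complex_hilbert set" and H' :: "nat \<Rightarrow> 'b::complex_hilbert set"
  assumes F: "flag_operator \<Omega> n H T D S" and F': "flag_operator \<Omega> n H' T' D' S'"
    and U: "unitary_op UNIV UNIV U" and UT: "\<And>x. U (T x) = T' (U x)"
  shows "\<And>i. i < n \<Longrightarrow> unitary_op (H i) (H' i) U"
    "\<And>i x. i < n \<Longrightarrow> x \<in> H i \<Longrightarrow> U (D i x) = D' i (U x)"
    "\<And>i j x. i < j \<Longrightarrow> j < n \<Longrightarrow> x \<in> H j \<Longrightarrow> U (S i j x) = S' i j (U x)"
proof -
  note bU = unitary_op_bounded[OF U]
  have "inj U"
  proof (rule injI)
    fix x y assume "U x = U y"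
    then have "U (x - y) = 0" using bounded_op_diff[OF closed_csubspace_UNIV bU] by simp
    then show "x = y" using unitary_op_norm[OF U, of "x - y"] by simp
  qed
  moreover have "surj U" using U by (simp add: unitary_op_def)
  ultimately have inv: "inv U (U x) = x" "U (inv U y) = y" for x y
    by (auto simp: surj_f_inv_f)
  have cinv: "cinner (U x) y = cinner x (inv U y)" for x y
    using U inv by (metis UNIV_I unitary_op_def)
  have lin: "U (x + y) = U x + U y" "U (c *\<^sub>C x) = c *\<^sub>C U x" for x y c
    using bounded_opD(2,3)[OF bU] by simp_all
  have binv: "bounded_op UNIV UNIV (inv U)"
  proof (rule bounded_opI[where C = 1])
    show "inv U (x + y) = inv U x + inv U y" for x y by (metis inv lin(1))
    show "inv U (c *\<^sub>C x) = c *\<^sub>C inv U x" for c x by (metis inv lin(2))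
    show "norm (inv U x) \<le> 1 * norm x" for x
      using unitary_op_norm[OF U, of "inv U x"] inv by simp
  qed simp
  have invT: "inv U (T' y) = T (inv U y)" for y by (metis inv UT)
  interpret flag_unitary \<Omega> n H T D S H' T' D' S' U "inv U"
    by (intro flag_unitary.intro flag_intertwining.intro flag_intertwining_axioms.intro
        flag_unitary_axioms.intro F F' bU binv UT invT inv cinv)
  show "unitary_op (H i) (H' i) U" if "i < n" for i
    using U diagonal[OF that] by (auto simp: unitary_op_def clinear_on_def)
  show "U (D i x) = D' i (U x)" if "i < n" "x \<in> H i" for i x
    using entries[OF that(1,1,2)] by simp
  show "U (S i j x) = S' i j (U x)" if "i < j" "j < n" "x \<in> H j" for i j x
    using entries[of i j x] that by simp
qed

lemma blocks_imp_unitary_equivalence: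
  fixes H :: "nat \<Rightarrow> 'a::complex_hilbert set" and H' :: "nat \<Rightarrow> 'b::complex_hilbert set"
  assumes F: "flag_operator \<Omega> n H T D S" and F': "flag_operator \<Omega> n H' T' D' S'"
    and U: "\<And>i. i < n \<Longrightarrow> unitary_op (H i) (H' i) (U i)"
    and UD: "\<And>i x. i < n \<Longrightarrow> x \<in> H i \<Longrightarrow> U i (D i x) = D' i (U i x)"
    and US: "\<And>i j x. i < j \<Longrightarrow> j < n \<Longrightarrow> x \<in> H j \<Longrightarrow> U i (S i j x) = S' i j (U j x)"
  shows "unitarily_equivalent T T'"
proof -
  interpret src: flag_operator \<Omega> n H T D S by (rule F)
  interpret tgt: flag_operator \<Omega> n H' T' D' S' by (rule F')
  let ?c = "component n H"
  note c = component_mem[OF src.direct_sum] and bU = unitary_op_bounded[OF U]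
  define V where "V x = (\<Sum>i<n. U i (?c i x))" for x
  have bUc: "bounded_op UNIV (H' i) (\<lambda>x. U i (?c i x))" if "i < n" for i
    using bounded_op_compose[OF bounded_op_component[OF src.direct_sum that] bU[OF that]] .
  have isometry: "cinner (V x) (V y) = cinner x y" for x y
  proof -
    have "cinner (V x) (V y) = (\<Sum>i<n. cinner (U i (?c i x)) (U i (?c i y)))"
      unfolding V_def
      by (rule cinner_sum_orthogonal[OF tgt.direct_sum]) (auto intro: bounded_opD(1)[OF bUc])
    also have "\<dots> = (\<Sum>i<n. cinner (?c i x) (?c i y))"
      using U c by (intro sum.cong) (auto simp: unitary_op_def)
    finally show ?thesis by (simp only: cinner_eq_sum_component[OF src.direct_sum, symmetric])
  qed
  have lin: "V (x + y) = V x + V y" "V (a *\<^sub>C x) = a *\<^sub>C V x" for x y a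
    using bounded_opD(2,3)[OF bUc]
    by (simp_all add: V_def sum.distrib complex_vector.scale_sum_right)
  have V_sum: "V (\<Sum>i<n. f i) = (\<Sum>i<n. U i (f i))" if "\<And>i. i < n \<Longrightarrow> f i \<in> H i" for f
    unfolding V_def using component_unique[OF src.direct_sum that] by simp
  have "surj V"
  proof (rule surjI)
    fix y
    \<comment> \<open>Each \<open>U i\<close> is inverted only between the summands, as its values
      elsewhere are arbitrary.\<close>
    let ?f = "\<lambda>i. inv_into (H i) (U i) (component n H' i y)"
    have img: "component n H' i y \<in> U i ` H i" if "i < n" for i
      using U[OF that] component_mem[OF tgt.direct_sum that] by (auto simp: unitary_op_def)
    have "V (\<Sum>i<n. ?f i) = (\<Sum>i<n. U i (?f i))"
      by (rule V_sum) (rule inv_into_into[OF img])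
    also have "\<dots> = (\<Sum>i<n. component n H' i y)"
      by (rule sum.cong) (auto intro: f_inv_into_f[OF img])
    finally show "V (\<Sum>i<n. ?f i) = y" by (simp add: sum_component[OF tgt.direct_sum])
  qed
  then have V: "unitary_op UNIV UNIV V"
    using lin isometry by (auto simp: unitary_op_def clinear_on_def)
  have "V (T x) = T' (V x)" for x
  proof (rule bounded_op_eq_if_eq_on_summands[OF src.direct_sum])
    show "bounded_op UNIV UNIV (\<lambda>x. V (T x))" "bounded_op UNIV UNIV (\<lambda>x. T' (V x))"
      using bounded_op_compose[OF src.bounded_T unitary_op_bounded[OF V]]
        bounded_op_compose[OF unitary_op_bounded[OF V] tgt.bounded_T] .
    fix j x assume j: "j < n" and x: "x \<in> H j"
    have Ux: "U j x \<in> H' j" by (rule bounded_opD(1)[OF bU[OF j] x])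
    have "V x = (\<Sum>i<n. if i = j then U j x else 0)"
      unfolding V_def
    proof (rule sum.cong)
      fix i assume "i \<in> {..<n}"
      then show "U i (?c i x) = (if i = j then U j x else 0)"
        using component_same[OF src.direct_sum j x] component_other[OF src.direct_sum j _ _ x]
          bounded_op_0[OF src.closed_summand bU] by auto
    qed simp
    then have "V x = U j x" using j by simp
    then have "T' (V x) = (\<Sum>i<n. flag_matrix D' S' i j (U j x))"
      using tgt.T_eq_column_sum[OF j Ux] by simp
    also have "\<dots> = (\<Sum>i<n. U i (flag_matrix D S i j x))"
      using UD US j x bounded_op_0[OF src.closed_summand bU] by (intro sum.cong) auto
    also have "\<dots> = V (\<Sum>i<n. flag_matrix D S i j x)"
      by (rule V_sum[symmetric]) (rule bounded_opD(1)[OF src.bounded_entry[OF _ j] x])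
    finally show "V (T x) = T' (V x)" by (simp only: src.T_eq_column_sum[OF j x])
  qed
  then show ?thesis unfolding unitarily_equivalent_def using V by blast
qed

theorem theorem3p4:
  fixes \<Omega> :: "complex set" and n :: nat
    and T :: "'a::complex_hilbert \<Rightarrow> 'a" and T' :: "'b::complex_hilbert \<Rightarrow> 'b"
    and H :: "nat \<Rightarrow> 'a set" and H' :: "nat \<Rightarrow> 'b set"
    and D :: "nat \<Rightarrow> 'a \<Rightarrow> 'a" and D' :: "nat \<Rightarrow> 'b \<Rightarrow> 'b"
    and S :: "nat \<Rightarrow> nat \<Rightarrow> 'a \<Rightarrow> 'a" and S' :: "nat \<Rightarrow> nat \<Rightarrow> 'b \<Rightarrow> 'b"
  assumes "open \<Omega>" and "connected \<Omega>" and "0 < n"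
    and "FB_class n \<Omega> H T D S" and "FB_class n \<Omega> H' T' D' S'"
  shows "unitarily_equivalent T T' \<longleftrightarrow>
    (\<exists>U :: nat \<Rightarrow> 'a \<Rightarrow> 'b.
      (\<forall>i<n. unitary_op (H i) (H' i) (U i))
      \<and> (\<forall>i<n. \<forall>x\<in>H i. U i (D i x) = D' i (U i x))
      \<and> (\<forall>i j. i < j \<and> j < n \<longrightarrow> (\<forall>x\<in>H j. U i (S i j x) = S' i j (U j x))))"
    (is "_ \<longleftrightarrow> ?blocks")
proof
  have F: "flag_operator \<Omega> n H T D S" "flag_operator \<Omega> n H' T' D' S'"
    using assms by (auto intro: flag_operator.intro)
  {
    assume "unitarily_equivalent T T'"
    then obtain U where "unitary_op UNIV UNIV U" "\<And>x. U (T x) = T' (U x)"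
      by (auto simp: unitarily_equivalent_def)
    \<comment> \<open>All blocks are given by \<open>U\<close> itself: an operator between summands
      is a total function whose values count only on its summand.\<close>
    from unitary_equivalence_imp_blocks[OF F this] show ?blocks
      by (intro exI[of _ "\<lambda>_. U"]) simp
  next
    assume ?blocks
    then obtain U where "\<forall>i<n. unitary_op (H i) (H' i) (U i)"
      "\<forall>i<n. \<forall>x\<in>H i. U i (D i x) = D' i (U i x)"
      "\<forall>i j. i < j \<and> j < n \<longrightarrow> (\<forall>x\<in>H j. U i (S i j x) = S' i j (U j x))" by (elim exE conjE)
    then show "unitarily_equivalent T T'"
      by (intro blocks_imp_unitary_equivalence[OF F, of U]) simp_all
  }
qed

end
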